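(* Let $\mathbb{F}$ be any field, let $m,n\ge 1$ be integers, and let $A\in\mathbb{F}^{m\times m}$, $B\in\mathbb{F}^{n\times n}$, $S\in\mathbb{F}^{m\times n}$. Then the $\mathbb{F}$-linear span of $\{A^iSB^j : i,j\ge 0\}$ is equal to $\mathbb{F}^{m\times n}$ if and only if both of the following conditions hold: (i) $A$ and $B$ are cyclic; (ii) $uSv\neq 0$ for every left eigenvector $u$ of $A$ and every right eigenvector $v$ of $B$.
   Context: A square matrix $M$ over $\mathbb{F}$ is cyclic (non-derogatory) if its minimal polynomial equals its characteristic polynomial $\det(sI-M)$ (equivalently, $M$ is similar to a companion matrix; equivalently, each eigenspace of $M$ has dimension 1). Eigenvalues are the zeros of the characteristic polynomial in an extension field of $\mathbb{F}$; eigenvalues and eigenvectors of all matrices are taken over a common extension field of $\mathbb{F}$ containing all the eigenvalues (e.g. an algebraic closure $\overline{\mathbb{F}}$). A left eigenvector of $A$ is a nonzero row vector $u$ with $uA=\lambda u$ for some eigenvalue $\lambda$ of $A$; a right eigenvector of $B$ is a nonzero column vector $v$ with $Bv=\lambda v$ for some eigenvalue $\lambda$ of $B$. *)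

theory Defs
  imports "Jordan_Normal_Form.Char_Poly" "Jordan_Normal_Form.VS_Connect"
begin

definition mat_poly_eval :: "'a::field poly \<Rightarrow> 'a mat \<Rightarrow> 'a mat" where
  "mat_poly_eval p A =
     (\<Oplus>\<^bsub>module_mat TYPE('a) (dim_row A) (dim_row A)\<^esub> i \<in> {..degree p}. coeff p i \<cdot>\<^sub>m (A ^\<^sub>m i))"

definition is_minimal_poly :: "'a::field mat \<Rightarrow> 'a poly \<Rightarrow> bool" where
  "is_minimal_poly A p \<longleftrightarrow>
     monic p \<and> mat_poly_eval p A = 0\<^sub>m (dim_row A) (dim_row A) \<and>
     (\<forall>q. q \<noteq> 0 \<and> mat_poly_eval q A = 0\<^sub>m (dim_row A) (dim_row A) \<longrightarrow> degree p \<le> degree q)"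

text \<open>The minimal polynomial is given by its defining property, a monic annihilating polynomial
  of least degree; two such polynomials are equal, since otherwise a scalar multiple of their
  difference would annihilate the matrix in smaller degree.\<close>

definition cyclic_mat :: "'a::field mat \<Rightarrow> bool" where
  "cyclic_mat A \<longleftrightarrow> square_mat A \<and> is_minimal_poly A (char_poly A)"

definition splits_under :: "('a::field \<Rightarrow> 'k::field) \<Rightarrow> 'a poly \<Rightarrow> bool" where
  "splits_under h p \<longleftrightarrow> (\<exists>c as. map_poly h p = Polynomial.smult c (\<Prod>a\<leftarrow>as. [:- a, 1:]))"

text \<open>For a field extension \<open>h : F \<rightarrow> K\<close>, the eigenvalues in \<open>K\<close> of a matrix over \<open>F\<close> are the zeros
  of the characteristic polynomial of its image over \<open>K\<close>.  The predicates below are applied to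
  that image.  A vector \<open>u\<close> is read as a row through \<open>mat_of_row\<close>.\<close>

definition left_eigenvec :: "'k::field mat \<Rightarrow> 'k vec \<Rightarrow> bool" where
  "left_eigenvec A u \<longleftrightarrow>
     u \<in> carrier_vec (dim_row A) \<and> u \<noteq> 0\<^sub>v (dim_row A) \<and>
     (\<exists>c. poly (char_poly A) c = 0 \<and> mat_of_row u * A = c \<cdot>\<^sub>m mat_of_row u)"

definition right_eigenvec :: "'k::field mat \<Rightarrow> 'k vec \<Rightarrow> bool" where
  "right_eigenvec B v \<longleftrightarrow> (\<exists>c. poly (char_poly B) c = 0 \<and> eigenvector B v c)"

abbreviation mat_span :: "nat \<Rightarrow> nat \<Rightarrow> 'a::field mat set \<Rightarrow> 'a mat set" where
  "mat_span m n \<equiv> LinearCombinations.module.span class_ring (module_mat TYPE('a) m n)"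

end

theory Submission
  imports Defs
begin

text \<open>By the Cayley-Hamilton theorem the span is generated by the \<open>m n\<close> matrices \<open>A^i S B^j\<close> with
  \<open>i < m\<close> and \<open>j < n\<close>, so it is everything iff no nonzero polynomial \<open>c(x,y)\<close> of degree below
  \<open>m\<close> in \<open>x\<close> and below \<open>n\<close> in \<open>y\<close> satisfies \<open>c(A,B) = 0\<close>, where \<open>x^i y^j\<close> is evaluated to
  \<open>A^i S B^j\<close>.  A polynomial in one variable annihilating \<open>A\<close> or \<open>B\<close> is such a relation, and
  \<open>u S v = 0\<close> for eigenvectors forces \<open>u X v = 0\<close> on the whole span.

  Conversely, over the splitting field a relation \<open>c\<close> can be multiplied by linear factors of the
  characteristic polynomials \<open>p\<close> and \<open>q\<close> until it becomes, up to a scalar,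
  \<open>p(x)/(x - a) * q(y)/(y - b)\<close> modulo \<open>(p, q)\<close>.  For cyclic \<open>A\<close> and \<open>B\<close> both factors remain
  nonzero after evaluation.  The nonzero rows of the first are left eigenvectors of \<open>A\<close>, the
  nonzero columns of the second are right eigenvectors of \<open>B\<close>, and the relation says that they
  pair to zero.\<close>

section \<open>Evaluation of polynomials at matrices\<close>

text \<open>Horner's scheme is needed twice: with \<open>\<phi> a\<close> the scalar matrix of
  \<open>a\<close>, and with \<open>\<phi> f\<close> the matrix \<open>peval A f * S\<close>. The
  coefficients therefore lie in a ring of their own, and only additivity of \<open>\<phi>\<close> is
  assumed.\<close>

locale matrix_horner =
  fixes m n :: nat and \<phi> :: "'c::comm_ring_1 \<Rightarrow> 'a::comm_ring_1 mat" and B :: "'a mat"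
  assumes B_carrier: "B \<in> carrier_mat n n"
    and \<phi>_carrier: "\<phi> a \<in> carrier_mat m n"
    and \<phi>_zero: "\<phi> 0 = 0\<^sub>m m n"
    and \<phi>_add: "\<phi> (a + b) = \<phi> a + \<phi> b"
begin

definition horner :: "'c poly \<Rightarrow> 'a mat" where
  "horner c = fold_coeffs (\<lambda>a M. \<phi> a + M * B) c (0\<^sub>m m n)"

lemma horner_zero [simp]: "horner 0 = 0\<^sub>m m n"
  by (simp add: horner_def)

lemma horner_pCons: "horner (pCons a c) = \<phi> a + horner c * B"
  using B_carrier by (cases "c = 0"; cases "a = 0")
    (auto simp: horner_def \<phi>_zero \<phi>_carrier intro!: right_add_zero_mat[symmetric])

lemma horner_carrier: "horner c \<in> carrier_mat m n"
  using B_carrier by (induction c) (auto simp: horner_pCons \<phi>_carrier)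

lemma horner_const: "horner [:a:] = \<phi> a"
  using B_carrier \<phi>_carrier[of a] by (simp add: horner_pCons)

lemma horner_add: "horner (c + d) = horner c + horner d"
proof (induction c d rule: poly_induct2)
  case 0
  then show ?case by simp
next
  case (pCons a c b d)
  have "horner (pCons a c + pCons b d) = (\<phi> a + \<phi> b) + (horner c * B + horner d * B)"
    using B_carrier horner_carrier[of c] horner_carrier[of d]
    by (simp add: horner_pCons pCons \<phi>_add add_mult_distrib_mat)
  also have "\<dots> = horner (pCons a c) + horner (pCons b d)"
    using B_carrier horner_carrier[of c] horner_carrier[of d] \<phi>_carrier[of a] \<phi>_carrier[of b]
    by (intro eq_matI) (auto simp: horner_pCons)
  finally show ?case .
qed

text \<open>Each Horner step multiplies by \<open>B\<close> on the right and shifts the exponents by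
  one. Stating this for entries keeps the sum in the ring, and a free bound \<open>N\<close> lets
  later sums run over a fixed range instead of up to the degree.\<close>

lemma horner_index:
  assumes "\<And>j. j \<ge> N \<Longrightarrow> coeff c j = 0" and "k < m" and "l < n"
  shows "horner c $$ (k,l) = (\<Sum>j<N. (\<phi> (coeff c j) * B ^\<^sub>m j) $$ (k,l))"
  using assms
proof (induction c arbitrary: N l)
  case 0
  have "0\<^sub>m m n * B ^\<^sub>m j = 0\<^sub>m m n" for j
    by (rule left_mult_zero_mat[OF pow_carrier_mat[OF B_carrier]])
  then show ?case using 0 by (simp add: \<phi>_zero)
next
  case (pCons a c)
  \<comment> \<open>The bound 0 would force \<open>pCons a c\<close> to vanish, which this case of
    the induction excludes.\<close>
  have "N \<noteq> 0"
  proof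
    assume "N = 0"
    then have "pCons a c = 0" using pCons.prems(1) by (intro poly_eqI) simp
    then show False using pCons.hyps by auto
  qed
  then obtain N' where N: "N = Suc N'" by (cases N) auto
  have "coeff c j = 0" if "j \<ge> N'" for j
    using pCons.prems(1)[of "Suc j"] that N by simp
  then have IH: "horner c $$ (k,t) = (\<Sum>j<N'. (\<phi> (coeff c j) * B ^\<^sub>m j) $$ (k,t))" if "t < n" for t
    using pCons.IH[of N' t] that pCons.prems(2) by simp
  have B: "B \<in> carrier_mat n n" by (fact B_carrier)
  have "horner c * B \<in> carrier_mat m n" using horner_carrier[of c] B by auto
  then have "horner (pCons a c) $$ (k,l) = \<phi> a $$ (k,l) + (horner c * B) $$ (k,l)"
    using pCons.prems \<phi>_carrier[of a] by (simp add: horner_pCons del: index_mult_mat)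
  also have "(horner c * B) $$ (k,l) = (\<Sum>t<n. horner c $$ (k,t) * B $$ (t,l))"
    using pCons.prems B horner_carrier[of c]
    by (auto simp: scalar_prod_def atLeast0LessThan intro!: sum.cong)
  also have "\<dots> = (\<Sum>t<n. \<Sum>j<N'. (\<phi> (coeff c j) * B ^\<^sub>m j) $$ (k,t) * B $$ (t,l))"
    by (simp add: IH sum_distrib_right)
  also have "\<dots> = (\<Sum>j<N'. \<Sum>t<n. (\<phi> (coeff c j) * B ^\<^sub>m j) $$ (k,t) * B $$ (t,l))"
    by (rule sum.swap)
  also have "\<dots> = (\<Sum>j<N'. (\<phi> (coeff c j) * B ^\<^sub>m Suc j) $$ (k,l))"
  proof (rule sum.cong[OF refl])
    fix j
    have P: "B ^\<^sub>m j \<in> carrier_mat n n" using B by simp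
    have C: "\<phi> (coeff c j) \<in> carrier_mat m n" by (fact \<phi>_carrier)
    have "\<phi> (coeff c j) * B ^\<^sub>m Suc j = (\<phi> (coeff c j) * B ^\<^sub>m j) * B"
      using assoc_mult_mat[OF C P B] by simp
    then show "(\<Sum>t<n. (\<phi> (coeff c j) * B ^\<^sub>m j) $$ (k,t) * B $$ (t,l)) =
        (\<phi> (coeff c j) * B ^\<^sub>m Suc j) $$ (k,l)"
      using pCons.prems B P C
      by (auto simp: scalar_prod_def atLeast0LessThan simp del: assoc_mult_mat intro!: sum.cong)
  qed
  also have "\<phi> a $$ (k,l) + \<dots> = (\<Sum>j<N. (\<phi> (coeff (pCons a c) j) * B ^\<^sub>m j) $$ (k,l))"
    using B \<phi>_carrier[of a] unfolding N sum.lessThan_Suc_shift by simp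
  finally show ?case .
qed

end

section \<open>Polynomials in one square matrix and the Cayley-Hamilton theorem\<close>

definition peval :: "'a::comm_ring_1 mat \<Rightarrow> 'a poly \<Rightarrow> 'a mat" where
  "peval A = matrix_horner.horner (dim_row A) (dim_row A) (\<lambda>a. a \<cdot>\<^sub>m 1\<^sub>m (dim_row A)) A"

context
  fixes A :: "'a::comm_ring_1 mat" and m :: nat
  assumes A: "A \<in> carrier_mat m m"
begin

interpretation matrix_horner m m "\<lambda>a. a \<cdot>\<^sub>m 1\<^sub>m m" A
  using A by unfold_locales (auto simp: add_smult_distrib_right_mat)

private lemma peval_horner: "peval A = horner"
  using A by (simp add: peval_def)

lemma peval_zero [simp]: "peval A 0 = 0\<^sub>m m m"
  and peval_pCons: "peval A (pCons a f) = a \<cdot>\<^sub>m 1\<^sub>m m + peval A f * A"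
  and peval_carrier: "peval A f \<in> carrier_mat m m"
  and peval_const: "peval A [:a:] = a \<cdot>\<^sub>m 1\<^sub>m m"
  and peval_add: "peval A (f + g) = peval A f + peval A g"
  unfolding peval_horner
  by (fact horner_zero horner_pCons horner_carrier horner_const horner_add)+

lemma peval_index:
  assumes "\<And>i. i \<ge> N \<Longrightarrow> coeff f i = 0" and "k < m" and "l < m"
  shows "peval A f $$ (k,l) = (\<Sum>i<N. coeff f i * (A ^\<^sub>m i) $$ (k,l))"
proof -
  have "((a \<cdot>\<^sub>m 1\<^sub>m m) * A ^\<^sub>m i) $$ (k,l) = a * (A ^\<^sub>m i) $$ (k,l)" for a i
  proof -
    have P: "A ^\<^sub>m i \<in> carrier_mat m m" using A by simp
    have d: "dim_row (A ^\<^sub>m i) = m" "dim_col (A ^\<^sub>m i) = m" using P by auto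
    show ?thesis using d assms(2,3)
      by (simp del: pow_mat_dim pow_mat_dim_square add: mult_smult_assoc_mat[OF one_carrier_mat P] left_mult_one_mat[OF P])
  qed
  then show ?thesis unfolding peval_horner using horner_index[OF assms] by simp
qed

lemma peval_smult: "peval A (Polynomial.smult a f) = a \<cdot>\<^sub>m peval A f"
proof (induction f)
  case 0
  then show ?case by simp
next
  case (pCons b f)
  have F: "peval A f \<in> carrier_mat m m" by (rule peval_carrier)
  have FA: "peval A f * A \<in> carrier_mat m m" using F A by simp
  have "(a * b) \<cdot>\<^sub>m 1\<^sub>m m + a \<cdot>\<^sub>m (peval A f * A) = a \<cdot>\<^sub>m (b \<cdot>\<^sub>m 1\<^sub>m m + peval A f * A)"
    using FA by (intro eq_matI) (auto simp: ring_distribs simp del: index_mult_mat)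
  then show ?case
    by (simp add: peval_pCons pCons mult_smult_assoc_mat[OF F A])
qed

lemma peval_mult: "peval A (f * g) = peval A f * peval A g"
proof (induction g)
  case 0
  then show ?case using peval_carrier[of f] by simp
next
  case (pCons a g)
  have F: "peval A f \<in> carrier_mat m m" and G: "peval A g \<in> carrier_mat m m"
    by (rule peval_carrier)+
  have "peval A (f * pCons a g) = a \<cdot>\<^sub>m peval A f + (0 \<cdot>\<^sub>m 1\<^sub>m m + peval A f * peval A g * A)"
    by (simp add: peval_add peval_smult peval_pCons pCons)
  also have "0 \<cdot>\<^sub>m 1\<^sub>m m + peval A f * peval A g * A = peval A f * (peval A g * A)"
    using F G A assoc_mult_mat[OF F G A] by (intro eq_matI) auto
  also have "a \<cdot>\<^sub>m peval A f + \<dots> = peval A f * (a \<cdot>\<^sub>m 1\<^sub>m m + peval A g * A)"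
  proof -
    have "a \<cdot>\<^sub>m 1\<^sub>m m \<in> carrier_mat m m" and "peval A g * A \<in> carrier_mat m m" using G A by auto
    from mult_add_distrib_mat[OF F this] show ?thesis
      by (simp add: mult_smult_distrib[OF F one_carrier_mat] right_mult_one_mat[OF F])
  qed
  finally show ?case by (simp add: peval_pCons)
qed

lemma peval_mult_commute: "peval A f * peval A g = peval A g * peval A f"
  by (metis peval_mult mult.commute)

lemma peval_X: "peval A [:0, 1:] = A"
  using A by (simp add: peval_pCons) (intro eq_matI, auto)

lemma peval_monom: "peval A (monom 1 i) = A ^\<^sub>m i"
  using A
proof (induction i)
  case 0
  then show ?case by (simp add: monom_0 peval_const) (intro eq_matI, auto)
next
  case (Suc i)
  then show ?case using pow_carrier_mat[OF A, of i]
    by (simp add: monom_Suc peval_pCons) (intro eq_matI, auto)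
qed

lemma peval_sum_index:
  assumes "finite I" and "k < m" and "l < m"
  shows "peval A (sum f I) $$ (k,l) = (\<Sum>i\<in>I. peval A (f i) $$ (k,l))"
  using assms(1)
proof (induction I)
  case empty
  then show ?case using assms by simp
next
  case (insert i I)
  then show ?case
    using assms peval_carrier[of "f i"] peval_carrier[of "sum f I"] by (simp add: peval_add)
qed

text \<open>Evaluate \<open>adj (x I - A) (x I - A) = p I\<close> at \<open>A\<close> from the right, entry by entry: the
  factor \<open>x I - A\<close> vanishes at \<open>A\<close>.\<close>

theorem Cayley_Hamilton: "peval A (char_poly A) = 0\<^sub>m m m"
proof (rule eq_matI)
  fix k l assume kl: "k < dim_row (0\<^sub>m m m :: 'a mat)" "l < dim_col (0\<^sub>m m m :: 'a mat)"
  then have k: "k < m" and l: "l < m" by auto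
  define M where "M = char_poly_matrix A"
  have M: "M \<in> carrier_mat m m" using A by (simp add: M_def)
  define D where "D = adj_mat M"
  have D: "D \<in> carrier_mat m m" using adj_mat(1)[OF M] by (simp add: D_def)
  have DM: "D * M = char_poly A \<cdot>\<^sub>m 1\<^sub>m m"
    using adj_mat(3)[OF M] by (simp add: D_def M_def char_poly_def)
  have Mst: "M $$ (s,t) = (if s = t then monom 1 1 else 0) - [:A $$ (s,t):]" if "s < m" "t < m" for s t
    using that A by (simp add: M_def char_poly_matrix_def monom_altdef)
  \<comment> \<open>At \<open>A\<close>, the entry \<open>M $$ (s,t)\<close> is \<open>A\<close> on
    the diagonal minus the scalar \<open>A $$ (s,t)\<close>. With \<open>P\<close> the value of
    \<open>f\<close>, summing over \<open>t\<close> computes entry \<open>(s,l)\<close> of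
    \<open>A * P\<close> in two ways, and they cancel.\<close>
  have zero: "(\<Sum>t<m. peval A (M $$ (s,t) * f) $$ (t,l)) = 0" if s: "s < m" for s f
  proof -
    define P where "P = peval A f"
    have P: "P \<in> carrier_mat m m" using peval_carrier by (simp add: P_def)
    have "peval A (M $$ (s,t) * f) $$ (t,l) =
        (if s = t then (A * P) $$ (t,l) else 0) - A $$ (s,t) * P $$ (t,l)" if t: "t < m" for t
    proof -
      have "peval A (monom 1 1 * f) = A * P"
        using A unfolding peval_mult peval_monom P_def by simp
      moreover have "peval A (Polynomial.smult (- (A $$ (s,t))) f) = - (A $$ (s,t)) \<cdot>\<^sub>m P"
        unfolding peval_smult P_def ..
      moreover have "M $$ (s,t) * f =
          (if s = t then monom 1 1 * f else 0) + Polynomial.smult (- (A $$ (s,t))) f"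
        using s t by (simp add: Mst algebra_simps)
      ultimately show ?thesis using t l P A
        by (simp add: peval_add del: One_nat_def smult_minus_left add_uminus_conv_diff)
    qed
    then have "(\<Sum>t<m. peval A (M $$ (s,t) * f) $$ (t,l)) =
        (A * P) $$ (s,l) - (\<Sum>t<m. A $$ (s,t) * P $$ (t,l))"
      using s by (simp add: sum_subtractf)
    also have "\<dots> = 0"
      using s l A P by (simp add: scalar_prod_def atLeast0LessThan)
    finally show ?thesis .
  qed
  \<comment> \<open>In row \<open>k\<close> of the scalar matrix only the diagonal entry
    \<open>t = k\<close> contributes.\<close>
  have "peval A (char_poly A) $$ (k,l) =
      (\<Sum>t<m. peval A ((char_poly A \<cdot>\<^sub>m 1\<^sub>m m) $$ (k,t)) $$ (t,l))"
  proof -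
    have "(\<Sum>t<m. peval A ((char_poly A \<cdot>\<^sub>m 1\<^sub>m m) $$ (k,t)) $$ (t,l)) =
        (\<Sum>t<m. if t = k then peval A (char_poly A) $$ (k,l) else 0)"
      using k l by (intro sum.cong) auto
    then show ?thesis using k by simp
  qed
  \<comment> \<open>The scalar matrix is now \<open>D * M\<close>. Commutativity of polynomials
    brings the entry of \<open>M\<close> to the front, the shape required by
    \<open>zero\<close>.\<close>
  also have "\<dots> = (\<Sum>t<m. peval A (\<Sum>s<m. M $$ (s,t) * D $$ (k,s)) $$ (t,l))"
    unfolding DM[symmetric] using k D M
    by (intro sum.cong refl) (simp add: scalar_prod_def atLeast0LessThan mult.commute)
  also have "\<dots> = (\<Sum>t<m. \<Sum>s<m. peval A (M $$ (s,t) * D $$ (k,s)) $$ (t,l))"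
    using l by (intro sum.cong refl) (simp add: peval_sum_index)
  also have "\<dots> = (\<Sum>s<m. \<Sum>t<m. peval A (M $$ (s,t) * D $$ (k,s)) $$ (t,l))"
    by (rule sum.swap)
  also have "\<dots> = 0" using zero by simp
  finally show "peval A (char_poly A) $$ (k,l) = 0\<^sub>m m m $$ (k,l)" using k l by simp
qed (use peval_carrier[of "char_poly A"] in auto)

end

text \<open>Finite sums in the module of matrices are formed entrywise, so both sides have the
  entries given by \<open>peval_index\<close>.\<close>

lemma mat_poly_eval_eq_peval:
  fixes A :: "'a::field mat"
  assumes A: "A \<in> carrier_mat m m"
  shows "mat_poly_eval f A = peval A f"
proof -
  interpret abelian_group "module_mat TYPE('a) m m" by (rule abelian_group_mat)
  have sum: "(\<Oplus>\<^bsub>module_mat TYPE('a) m m\<^esub> i\<in>I. M i) \<in> carrier_mat m m \<and>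
      (\<forall>k<m. \<forall>l<m. (\<Oplus>\<^bsub>module_mat TYPE('a) m m\<^esub> i\<in>I. M i) $$ (k,l) = (\<Sum>i\<in>I. M i $$ (k,l)))"
    if "finite I" "\<And>i. M i \<in> carrier_mat m m" for I :: "nat set" and M
    using that(1)
  proof (induction I)
    case empty
    then show ?case by (simp add: module_mat_simps)
  next
    case (insert i I)
    have "(\<Oplus>\<^bsub>module_mat TYPE('a) m m\<^esub> i\<in>insert i I. M i) =
        M i + (\<Oplus>\<^bsub>module_mat TYPE('a) m m\<^esub> i\<in>I. M i)"
      using insert that(2) by (subst finsum_insert) (auto simp: module_mat_simps)
    then show ?case using insert that(2)[of i] by auto
  qed
  have carr: "coeff f i \<cdot>\<^sub>m A ^\<^sub>m i \<in> carrier_mat m m" for i using A by simp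
  show ?thesis
  proof (rule eq_matI)
    fix k l assume "k < dim_row (peval A f)" "l < dim_col (peval A f)"
    then have kl: "k < m" "l < m" using peval_carrier[OF A, of f] by auto
    have "mat_poly_eval f A $$ (k,l) = (\<Sum>i\<le>degree f. coeff f i * (A ^\<^sub>m i) $$ (k,l))"
      using sum[OF _ carr, of "{..degree f}" "\<lambda>i. i"] kl A by (simp add: mat_poly_eval_def)
    also have "\<dots> = peval A f $$ (k,l)"
      using kl by (subst peval_index[OF A, of "Suc (degree f)"])
        (auto simp: coeff_eq_0 lessThan_Suc_atMost)
    finally show "mat_poly_eval f A $$ (k,l) = peval A f $$ (k,l)" .
  qed (use sum[OF _ carr, of "{..degree f}" "\<lambda>i. i"] peval_carrier[OF A, of f] A in
      \<open>auto simp: mat_poly_eval_def\<close>)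
qed

lemma peval_mult_index:
  assumes A: "A \<in> carrier_mat m m" and X: "X \<in> carrier_mat m n"
    and "\<And>i. i \<ge> N \<Longrightarrow> coeff f i = 0" and k: "k < m" and l: "l < n"
  shows "(peval A f * X) $$ (k,l) = (\<Sum>i<N. coeff f i * (A ^\<^sub>m i * X) $$ (k,l))"
proof -
  have "(peval A f * X) $$ (k,l) = (\<Sum>t<m. peval A f $$ (k,t) * X $$ (t,l))"
    using k l X peval_carrier[OF A, of f] by (auto simp: scalar_prod_def atLeast0LessThan)
  also have "\<dots> = (\<Sum>t<m. \<Sum>i<N. coeff f i * (A ^\<^sub>m i) $$ (k,t) * X $$ (t,l))"
    using k assms(3) by (simp add: peval_index[OF A, of N] sum_distrib_right)
  also have "\<dots> = (\<Sum>i<N. \<Sum>t<m. coeff f i * (A ^\<^sub>m i) $$ (k,t) * X $$ (t,l))"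
    by (rule sum.swap)
  also have "\<dots> = (\<Sum>i<N. coeff f i * (A ^\<^sub>m i * X) $$ (k,l))"
  proof (rule sum.cong[OF refl])
    fix i
    have "dim_row (A ^\<^sub>m i) = m" "dim_col (A ^\<^sub>m i) = m"
      using pow_carrier_mat[OF A, of i] by auto
    then show "(\<Sum>t<m. coeff f i * (A ^\<^sub>m i) $$ (k,t) * X $$ (t,l)) =
        coeff f i * (A ^\<^sub>m i * X) $$ (k,l)"
      using k l X
      by (auto simp: scalar_prod_def atLeast0LessThan sum_distrib_left mult.assoc
          simp del: pow_mat_dim pow_mat_dim_square)
  qed
  finally show ?thesis .
qed

section \<open>Polynomials in two variables evaluated at a pair of matrices\<close>

text \<open>The outer polynomial variable is evaluated at \<open>B\<close>, the inner one at \<open>A\<close>, so that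
  \<open>x^i y^j\<close> is sent to \<open>A^i S B^j\<close>.\<close>

definition bieval :: "'a::comm_ring_1 mat \<Rightarrow> 'a mat \<Rightarrow> 'a mat \<Rightarrow> 'a poly poly \<Rightarrow> 'a mat" where
  "bieval A S B = matrix_horner.horner (dim_row A) (dim_row B) (\<lambda>f. peval A f * S) B"

context
  fixes A B S :: "'a::comm_ring_1 mat" and m n :: nat
  assumes A: "A \<in> carrier_mat m m" and B: "B \<in> carrier_mat n n" and S: "S \<in> carrier_mat m n"
begin

interpretation matrix_horner m n "\<lambda>f. peval A f * S" B
proof unfold_locales
  fix f g
  show "peval A f * S \<in> carrier_mat m n" by (rule mult_carrier_mat[OF peval_carrier[OF A] S])
  show "peval A (f + g) * S = peval A f * S + peval A g * S"
    by (simp add: peval_add[OF A] add_mult_distrib_mat[OF peval_carrier[OF A] peval_carrier[OF A] S])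
  show "peval A 0 * S = 0\<^sub>m m n" using S by (simp add: peval_zero[OF A])
qed (fact B)

private lemma bieval_horner: "bieval A S B = horner"
  using A B by (simp add: bieval_def)

lemma bieval_zero: "bieval A S B 0 = 0\<^sub>m m n"
  and bieval_pCons: "bieval A S B (pCons f c) = peval A f * S + bieval A S B c * B"
  and bieval_carrier: "bieval A S B c \<in> carrier_mat m n"
  and bieval_const: "bieval A S B [:f:] = peval A f * S"
  and bieval_add: "bieval A S B (c + d) = bieval A S B c + bieval A S B d"
  unfolding bieval_horner
  by (fact horner_zero horner_pCons horner_carrier horner_const horner_add)+

text \<open>A factor in the inner variable alone acts by left multiplication, because
  \<open>peval A\<close> is multiplicative.\<close>

lemma bieval_smult: "bieval A S B (Polynomial.smult d c) = peval A d * bieval A S B c"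
proof (induction c)
  case 0
  then show ?case using right_mult_zero_mat[OF peval_carrier[OF A]] by (simp add: bieval_zero)
next
  case (pCons f c)
  have D: "peval A d \<in> carrier_mat m m" and F: "peval A f \<in> carrier_mat m m"
    by (rule peval_carrier[OF A])+
  have C: "bieval A S B c \<in> carrier_mat m n" by (rule bieval_carrier)
  have FS: "peval A f * S \<in> carrier_mat m n" and CB: "bieval A S B c * B \<in> carrier_mat m n"
    using F S C B by auto
  show ?case
    by (simp add: bieval_pCons pCons peval_mult[OF A] assoc_mult_mat[OF D F S]
        assoc_mult_mat[OF D C B] mult_add_distrib_mat[OF D FS CB])
qed

text \<open>The coefficientwise embedding turns \<open>g\<close> into a polynomial in the outer
  variable alone. Scalar matrices pass through \<open>S\<close>, so its value collects on the
  right.\<close>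

lemma bieval_map_const: "bieval A S B (map_poly (\<lambda>a. [:a:]) g) = S * peval B g"
proof (induction g)
  case 0
  then show ?case using right_mult_zero_mat[OF S] by (simp add: bieval_zero peval_zero[OF B])
next
  case (pCons a g)
  have G: "peval B g \<in> carrier_mat n n" by (rule peval_carrier[OF B])
  have 1: "a \<cdot>\<^sub>m 1\<^sub>m n \<in> carrier_mat n n" and 2: "peval B g * B \<in> carrier_mat n n"
    using G B by auto
  have "(a \<cdot>\<^sub>m 1\<^sub>m m) * S = S * (a \<cdot>\<^sub>m 1\<^sub>m n)"
    by (simp add: mult_smult_assoc_mat[OF one_carrier_mat S] mult_smult_distrib[OF S one_carrier_mat]
        left_mult_one_mat[OF S] right_mult_one_mat[OF S])
  moreover have "map_poly (\<lambda>a. [:a:]) (pCons a g) = pCons [:a:] (map_poly (\<lambda>a. [:a:]) g)"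
    by (rule poly_eqI) (simp add: coeff_map_poly coeff_pCons split: nat.split)
  ultimately show ?case
    by (simp add: bieval_pCons pCons peval_pCons[OF B] peval_const[OF A]
        assoc_mult_mat[OF S G B] mult_add_distrib_mat[OF S 1 2])
qed

lemma bieval_index:
  assumes M: "\<And>i j. i \<ge> M \<Longrightarrow> coeff (coeff c j) i = 0"
    and N: "\<And>j. j \<ge> N \<Longrightarrow> coeff c j = 0" and k: "k < m" and l: "l < n"
  shows "bieval A S B c $$ (k,l) =
    (\<Sum>i<M. \<Sum>j<N. coeff (coeff c j) i * (A ^\<^sub>m i * S * B ^\<^sub>m j) $$ (k,l))"
proof -
  have "bieval A S B c $$ (k,l) = (\<Sum>j<N. (peval A (coeff c j) * S * B ^\<^sub>m j) $$ (k,l))"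
    unfolding bieval_horner by (rule horner_index[OF N k l])
  also have "\<dots> = (\<Sum>j<N. \<Sum>i<M. coeff (coeff c j) i * (A ^\<^sub>m i * S * B ^\<^sub>m j) $$ (k,l))"
  proof (rule sum.cong[OF refl])
    fix j
    have P: "B ^\<^sub>m j \<in> carrier_mat n n" by (rule pow_carrier_mat[OF B])
    have SP: "S * B ^\<^sub>m j \<in> carrier_mat m n" using S P by (rule mult_carrier_mat)
    show "(peval A (coeff c j) * S * B ^\<^sub>m j) $$ (k,l) =
        (\<Sum>i<M. coeff (coeff c j) i * (A ^\<^sub>m i * S * B ^\<^sub>m j) $$ (k,l))"
      using peval_mult_index[OF A SP _ k l, of M "coeff c j"] M
      by (simp add: assoc_mult_mat[OF peval_carrier[OF A] S P] assoc_mult_mat[OF pow_carrier_mat[OF A] S P])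
  qed
  also have "\<dots> = (\<Sum>i<M. \<Sum>j<N. coeff (coeff c j) i * (A ^\<^sub>m i * S * B ^\<^sub>m j) $$ (k,l))"
    by (rule sum.swap)
  finally show ?thesis .
qed

end

section \<open>Spanning and annihilated families of matrices\<close>

text \<open>The code \<open>s = i * n + j\<close> identifies pairs with numbers below
  \<open>m * n\<close>. It turns double sums into matrix-vector products, so that determinants
  become available.\<close>

lemma sum_div_mod:
  fixes m n :: nat
  shows "(\<Sum>s<m*n. f (s div n) (s mod n)) = (\<Sum>i<m. \<Sum>j<n. f i j)"
proof -
  have "(\<Sum>s<m*n. f (s div n) (s mod n)) = (\<Sum>i<m. \<Sum>s\<in>{i*n..<i*n+n}. f (s div n) (s mod n))"
    by (rule sum.nat_group[symmetric])
  also have "\<dots> = (\<Sum>i<m. \<Sum>j<n. f i j)"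
  proof (rule sum.cong[OF refl])
    fix i
    show "(\<Sum>s\<in>{i*n..<i*n+n}. f (s div n) (s mod n)) = (\<Sum>j<n. f i j)"
      by (rule sum.reindex_bij_witness[where i = "\<lambda>j. i*n+j" and j = "\<lambda>s. s - i*n"])
        (auto simp: mult.commute[of i] intro!: arg_cong2[where f = f] mod_nat_eqI[symmetric] div_nat_eqI[symmetric])
  qed
  finally show ?thesis .
qed

section \<open>Families of \<open>m * n\<close> arrays as a square linear system\<close>

context
  fixes M :: "nat \<Rightarrow> nat \<Rightarrow> nat \<Rightarrow> nat \<Rightarrow> 'a::field" and m n :: nat
begin

text \<open>The matrix of \<open>c \<mapsto> \<Sum>i j. c i j * M i j\<close>, where a pair \<open>(i,j)\<close> is coded as \<open>i * n + j\<close>.\<close>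

private definition "G = mat (m*n) (m*n) (\<lambda>(r,s). M (s div n) (s mod n) (r div n) (r mod n))"

private lemma G: "G \<in> carrier_mat (m*n) (m*n)"
  by (simp add: G_def)

private lemma pair_index: "k * n + l < m * n" if "k < m" "l < n"
proof -
  have "k * n + l < Suc k * n" using that by simp
  also have "\<dots> \<le> m * n" using that by (intro mult_right_mono) auto
  finally show ?thesis .
qed

private lemma G_mult_vec:
  assumes "v \<in> carrier_vec (m*n)" "k < m" "l < n"
  shows "(G *\<^sub>v v) $ (k*n+l) = (\<Sum>i<m. \<Sum>j<n. v $ (i*n+j) * M i j k l)"
proof -
  have "(G *\<^sub>v v) $ (k*n+l) = (\<Sum>s<m*n. v $ ((s div n)*n + s mod n) * M (s div n) (s mod n) k l)"
    using assms pair_index[OF assms(2,3)]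
    by (auto simp: G_def scalar_prod_def atLeast0LessThan intro!: sum.cong)
  also have "\<dots> = (\<Sum>i<m. \<Sum>j<n. v $ (i*n+j) * M i j k l)"
    by (rule sum_div_mod[where f = "\<lambda>i j. v $ (i*n+j) * M i j k l"])
  finally show ?thesis .
qed

private lemma vec_pairs:
  "vec (m*n) (\<lambda>s. c (s div n) (s mod n)) $ (i*n+j) = c i j" if "i < m" "j < n"
  using pair_index[OF that] that by simp

private lemma div_mod_bounds: "s div n < m" "s mod n < n" if "s < m * n"
proof -
  have "n > 0" using that by (cases n) auto
  then show "s div n < m" "s mod n < n" using that by (auto simp: less_mult_imp_div_less)
qed

private lemma G_kernel:
  assumes "v \<in> carrier_vec (m*n)" "\<And>k l. k < m \<Longrightarrow> l < n \<Longrightarrow> (\<Sum>i<m. \<Sum>j<n. v $ (i*n+j) * M i j k l) = 0"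
  shows "G *\<^sub>v v = 0\<^sub>v (m*n)"
proof (rule eq_vecI)
  fix r assume "r < dim_vec (0\<^sub>v (m*n) :: 'a vec)"
  then have r: "r < m * n" by simp
  show "(G *\<^sub>v v) $ r = 0\<^sub>v (m*n) $ r"
    using G_mult_vec[OF assms(1) div_mod_bounds[OF r]] assms(2)[OF div_mod_bounds[OF r]] r by simp
qed (use G in auto)

text \<open>There are as many members \<open>M i j\<close> as entries \<open>(k,l)\<close>, so
  \<open>G\<close> is square. If its determinant vanishes, a kernel vector gives a relation;
  otherwise the adjugate solves \<open>G *\<^sub>v v = x\<close> for every right-hand side.\<close>

lemma spanning_or_dependent:
  "(\<forall>X. \<exists>c. \<forall>k<m. \<forall>l<n. X k l = (\<Sum>i<m. \<Sum>j<n. c i j * M i j k l)) \<or>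
   (\<exists>c. (\<exists>i<m. \<exists>j<n. c i j \<noteq> 0) \<and> (\<forall>k<m. \<forall>l<n. (\<Sum>i<m. \<Sum>j<n. c i j * M i j k l) = 0))"
proof (cases "det G = 0")
  case True
  then obtain v where v: "v \<in> carrier_vec (m*n)" "v \<noteq> 0\<^sub>v (m*n)" "G *\<^sub>v v = 0\<^sub>v (m*n)"
    using det_0_iff_vec_prod_zero_field[OF G] by auto
  then obtain s where s: "s < m*n" "v $ s \<noteq> 0" by (metis carrier_vecD eq_vecI index_zero_vec)
  have "\<exists>i<m. \<exists>j<n. v $ (i*n+j) \<noteq> 0"
    using div_mod_bounds[OF s(1)] s(2) by (metis div_mult_mod_eq)
  moreover have "(\<Sum>i<m. \<Sum>j<n. v $ (i*n+j) * M i j k l) = 0" if "k < m" "l < n" for k l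
    using G_mult_vec[OF v(1) that] pair_index[OF that] by (simp add: v(3))
  ultimately show ?thesis by (intro disjI2 exI[of _ "\<lambda>i j. v $ (i*n+j)"]) auto
next
  case False
  have "\<exists>c. \<forall>k<m. \<forall>l<n. X k l = (\<Sum>i<m. \<Sum>j<n. c i j * M i j k l)" for X
  proof -
    define x where "x = vec (m*n) (\<lambda>s. X (s div n) (s mod n))"
    have x: "x \<in> carrier_vec (m*n)" by (simp add: x_def)
    define v where "v = (1 / det G) \<cdot>\<^sub>v (adj_mat G *\<^sub>v x)"
    have D: "adj_mat G \<in> carrier_mat (m*n) (m*n)" by (rule adj_mat(1)[OF G])
    have v: "v \<in> carrier_vec (m*n)" using D x by (simp add: v_def)
    have "G *\<^sub>v (adj_mat G *\<^sub>v x) = det G \<cdot>\<^sub>v x"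
    proof -
      have "(det G \<cdot>\<^sub>m 1\<^sub>m (m*n)) *\<^sub>v x = det G \<cdot>\<^sub>v x"
        using x by (intro eq_vecI) auto
      then show ?thesis by (simp add: assoc_mult_mat_vec[OF G D x, symmetric] adj_mat(2)[OF G])
    qed
    then have "G *\<^sub>v v = x"
      using False D x by (simp add: v_def mult_mat_vec[OF G] smult_smult_assoc)
    then have "X k l = (\<Sum>i<m. \<Sum>j<n. v $ (i*n+j) * M i j k l)" if "k < m" "l < n" for k l
      using G_mult_vec[OF v that] vec_pairs[OF that, of X] by (simp add: x_def)
    then show ?thesis by (intro exI[of _ "\<lambda>i j. v $ (i*n+j)"]) simp
  qed
  then show ?thesis by (intro disjI1 allI)
qed

text \<open>A relation makes \<open>det G\<close> vanish, hence also the determinant of the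
  transpose. A kernel vector of the transpose is a nonzero functional \<open>y\<close> on arrays
  that kills every \<open>M i j\<close>.\<close>

lemma dependent_imp_annihilated:
  assumes "\<exists>i<m. \<exists>j<n. c i j \<noteq> 0"
    and "\<And>k l. k < m \<Longrightarrow> l < n \<Longrightarrow> (\<Sum>i<m. \<Sum>j<n. c i j * M i j k l) = 0"
  shows "\<exists>y. (\<exists>k<m. \<exists>l<n. y k l \<noteq> 0) \<and>
    (\<forall>i<m. \<forall>j<n. (\<Sum>k<m. \<Sum>l<n. y k l * M i j k l) = 0)"
proof -
  define v where "v = vec (m*n) (\<lambda>s. c (s div n) (s mod n))"
  have v: "v \<in> carrier_vec (m*n)" by (simp add: v_def)
  have "G *\<^sub>v v = 0\<^sub>v (m*n)"
    by (rule G_kernel[OF v]) (use assms(2) in \<open>simp add: v_def vec_pairs\<close>)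
  moreover have "v \<noteq> 0\<^sub>v (m*n)"
  proof -
    obtain i j where ij: "i < m" "j < n" "c i j \<noteq> 0" using assms(1) by blast
    then have "v $ (i*n+j) \<noteq> 0" unfolding v_def by (simp only: vec_pairs not_False_eq_True)
    then show ?thesis using pair_index[OF ij(1,2)] by auto
  qed
  ultimately have "det G\<^sup>T = 0"
    using v det_0_iff_vec_prod_zero_field[OF G] det_transpose[OF G] by auto
  moreover have GT: "G\<^sup>T \<in> carrier_mat (m*n) (m*n)" using G by simp
  ultimately obtain w where w: "w \<in> carrier_vec (m*n)" "w \<noteq> 0\<^sub>v (m*n)" "G\<^sup>T *\<^sub>v w = 0\<^sub>v (m*n)"
    using det_0_iff_vec_prod_zero_field[OF GT] by auto
  then obtain s where s: "s < m*n" "w $ s \<noteq> 0" by (metis carrier_vecD eq_vecI index_zero_vec)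
  show ?thesis
  proof (intro exI[of _ "\<lambda>k l. w $ (k*n+l)"] conjI allI impI)
    show "\<exists>k<m. \<exists>l<n. w $ (k*n+l) \<noteq> 0"
      using div_mod_bounds[OF s(1)] s(2) by (metis div_mult_mod_eq)
  next
    fix i j assume ij: "i < m" "j < n"
    have "(\<Sum>k<m. \<Sum>l<n. w $ (k*n+l) * M i j k l) =
        (\<Sum>s<m*n. w $ ((s div n)*n + s mod n) * M i j (s div n) (s mod n))"
      by (rule sum_div_mod[symmetric, where f = "\<lambda>k l. w $ (k*n+l) * M i j k l"])
    also have "\<dots> = (G\<^sup>T *\<^sub>v w) $ (i*n+j)"
      using w(1) ij pair_index[OF ij]
      by (auto simp: G_def scalar_prod_def atLeast0LessThan intro!: sum.cong)
    finally show "(\<Sum>k<m. \<Sum>l<n. w $ (k*n+l) * M i j k l) = 0"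
      using pair_index[OF ij] by (simp add: w(3))
  qed
qed

end

text \<open>The kernel of \<open>\<psi>\<close> is a subspace. Values in a second field, with
  scalars carried over by \<open>h\<close>, allow functionals given by eigenvectors over the
  extension.\<close>

lemma mat_span_subset_kernel:
  fixes \<psi> :: "'a::field mat \<Rightarrow> 'k::field"
  assumes "U \<subseteq> carrier_mat m n"
    and add: "\<And>X Y. X \<in> carrier_mat m n \<Longrightarrow> Y \<in> carrier_mat m n \<Longrightarrow> \<psi> (X + Y) = \<psi> X + \<psi> Y"
    and smult: "\<And>a X. X \<in> carrier_mat m n \<Longrightarrow> \<psi> (a \<cdot>\<^sub>m X) = h a * \<psi> X"
    and "\<And>X. X \<in> U \<Longrightarrow> \<psi> X = 0" and "X \<in> mat_span m n U"
  shows "\<psi> X = 0"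
proof -
  interpret vectorspace class_ring "module_mat TYPE('a) m n" by (rule matrix_vs)
  have "\<psi> (0\<^sub>m m n + 0\<^sub>m m n) = \<psi> (0\<^sub>m m n) + \<psi> (0\<^sub>m m n)" by (rule add) auto
  then have zero: "\<psi> (0\<^sub>m m n) = 0" by (metis add_cancel_right_left left_add_zero_mat zero_carrier_mat)
  have "submodule class_ring {X \<in> carrier_mat m n. \<psi> X = 0} (module_mat TYPE('a) m n)"
    using module_axioms add smult zero by unfold_locales (auto simp: module_mat_simps submodule_def)
  from span_is_subset[OF _ this, of U] have "mat_span m n U \<subseteq> {X \<in> carrier_mat m n. \<psi> X = 0}"
    using assms(1,4) by blast
  then show ?thesis using assms(5) by blast
qed

text \<open>Passes from entrywise linear combinations to membership in the span, splitting off one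
  term at a time.\<close>

lemma sum_in_mat_span:
  fixes U :: "'a::field mat set"
  assumes "U \<subseteq> carrier_mat m n" and "finite I" and "\<And>i. i \<in> I \<Longrightarrow> M i \<in> U"
    and "X \<in> carrier_mat m n"
    and "\<And>k l. k < m \<Longrightarrow> l < n \<Longrightarrow> X $$ (k,l) = (\<Sum>i\<in>I. c i * M i $$ (k,l))"
  shows "X \<in> mat_span m n U"
  using assms(2-5)
proof (induction I arbitrary: X)
  case empty
  interpret vectorspace class_ring "module_mat TYPE('a) m n" by (rule matrix_vs)
  have "X = 0\<^sub>m m n" using empty by (intro eq_matI) auto
  then show ?case using span_zero[of U] by (simp add: module_mat_simps)
next
  case (insert i I)
  interpret vectorspace class_ring "module_mat TYPE('a) m n" by (rule matrix_vs)
  interpret s: submodule class_ring "mat_span m n U" "module_mat TYPE('a) m n"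
    using assms(1) by (intro span_is_submodule) (simp add: module_mat_simps)
  have Mi: "M i \<in> carrier_mat m n" using insert assms(1) by auto
  define Y where "Y = mat m n (\<lambda>(k,l). \<Sum>i\<in>I. c i * M i $$ (k,l))"
  have "Y \<in> mat_span m n U" by (rule insert.IH) (use insert.prems in \<open>auto simp: Y_def\<close>)
  moreover have "c i \<cdot>\<^sub>m M i \<in> mat_span m n U"
    using s.smult_closed[of "c i" "M i"] in_own_span[of U] assms(1) insert.prems(1)
    by (auto simp: module_mat_simps)
  moreover have "X = c i \<cdot>\<^sub>m M i + Y"
    using insert.prems(2,3) insert.hyps Mi by (intro eq_matI) (auto simp: Y_def)
  ultimately show ?case using s.m_closed[of "c i \<cdot>\<^sub>m M i" Y] by (simp add: module_mat_simps)
qed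

section \<open>Field extensions\<close>

text \<open>Through \<open>h\<close> the larger field is a vector space over the smaller one. The
  nonzero \<open>x\<close> is linearly independent, so prescribing the value 1 there extends to a
  linear functional.\<close>

lemma extension_functional:
  fixes h :: "'a::field \<Rightarrow> 'k::field" and x :: 'k
  assumes "field_hom h" and "x \<noteq> 0"
  shows "\<exists>\<phi> :: 'k \<Rightarrow> 'a. (\<forall>y z. \<phi> (y + z) = \<phi> y + \<phi> z) \<and>
    (\<forall>a y. \<phi> (h a * y) = a * \<phi> y) \<and> \<phi> x = 1"
proof -
  interpret field_hom h by fact
  interpret vector_space_pair "\<lambda>a y. h a * y" "(*) :: 'a \<Rightarrow> 'a \<Rightarrow> 'a"
    by unfold_locales (auto simp: hom_distribs algebra_simps)
  have "vs1.independent {x}" using assms(2) by simp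
  from linear_independent_extend[OF this, of "\<lambda>_. 1"] obtain \<phi> where
    \<phi>: "Vector_Spaces.linear (\<lambda>a y. h a * y) (*) \<phi>" "\<phi> x = 1" by auto
  interpret \<phi>: Vector_Spaces.linear "\<lambda>a y. h a * y" "(*)" \<phi> by (fact \<phi>(1))
  show ?thesis by (rule exI[of _ \<phi>]) (simp add: \<phi>.add \<phi>.scale \<phi>(2))
qed

text \<open>Evaluation uses only sums and products, which \<open>h\<close> preserves. The
  coefficients are mapped at both levels of the nested polynomial.\<close>

lemma bieval_hom:
  fixes h :: "'a::field \<Rightarrow> 'k::field"
  assumes "field_hom h"
    and A: "A \<in> carrier_mat m m" and B: "B \<in> carrier_mat n n" and S: "S \<in> carrier_mat m n"
  shows "bieval (map_mat h A) (map_mat h S) (map_mat h B) (map_poly (map_poly h) c) =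
    map_mat h (bieval A S B c)"
proof -
  interpret field_hom h by fact
  have peval: "peval (map_mat h A) (map_poly h f) = map_mat h (peval A f)" for f
  proof (induction f)
    case 0
    then show ?case using A by (simp add: peval_zero[of _ m]) (intro eq_matI, auto)
  next
    case (pCons a f)
    have hA: "map_mat h A \<in> carrier_mat m m" and P: "peval A f \<in> carrier_mat m m"
      using A by (auto intro: peval_carrier)
    have PA: "peval A f * A \<in> carrier_mat m m" using P A by simp
    have "peval (map_mat h A) (map_poly h (pCons a f)) = h a \<cdot>\<^sub>m 1\<^sub>m m + map_mat h (peval A f * A)"
      by (simp add: map_poly_pCons_hom peval_pCons[OF hA] pCons.IH mat_hom_mult[OF P A])
    also have "\<dots> = map_mat h (peval A (pCons a f))"
      unfolding peval_pCons[OF A] using PA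
      by (intro eq_matI) (auto simp: hom_distribs simp del: index_mult_mat)
    finally show ?case .
  qed
  have hA: "map_mat h A \<in> carrier_mat m m" and hB: "map_mat h B \<in> carrier_mat n n"
    and hS: "map_mat h S \<in> carrier_mat m n" using A B S by auto
  show ?thesis
  proof (induction c)
    case 0
    then show ?case by (simp add: bieval_zero[OF hA hB hS] bieval_zero[OF A B S]) (intro eq_matI, auto)
  next
    case (pCons f c)
    have P: "peval A f \<in> carrier_mat m m" and C: "bieval A S B c \<in> carrier_mat m n"
      using A by (auto intro: peval_carrier bieval_carrier[OF A B S])
    have 1: "peval A f * S \<in> carrier_mat m n" "bieval A S B c * B \<in> carrier_mat m n"
      using P C S B by auto
    have 2: "map_poly (map_poly h) (pCons f c) = pCons (map_poly h f) (map_poly (map_poly h) c)"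
      by (rule poly_eqI) (simp add: coeff_map_poly coeff_pCons split: nat.split)
    show ?case
      unfolding 2 bieval_pCons[OF hA hB hS] bieval_pCons[OF A B S] pCons.IH peval
        mat_hom_mult[OF P S, symmetric] mat_hom_mult[OF C B, symmetric]
      using 1 by (intro eq_matI) (auto simp: hom_add simp del: index_mult_mat)
  qed
qed

text \<open>The characteristic polynomial is monic of degree \<open>m\<close> and annihilates
  \<open>A\<close> by Cayley-Hamilton, so only minimality of the degree remains to be
  required.\<close>

lemma cyclic_mat_iff:
  fixes A :: "'a::field mat"
  assumes A: "A \<in> carrier_mat m m"
  shows "cyclic_mat A \<longleftrightarrow> (\<forall>q. q \<noteq> 0 \<and> peval A q = 0\<^sub>m m m \<longrightarrow> m \<le> degree q)"
proof -
  have "dim_row A = m" "square_mat A" using A by auto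
  then show ?thesis
    using degree_monic_char_poly[OF A] Cayley_Hamilton[OF A]
    by (simp add: cyclic_mat_def is_minimal_poly_def mat_poly_eval_eq_peval[OF A])
qed

text \<open>Linear independence of the powers of \<open>A\<close> survives the field extension: apply an
  \<open>F\<close>-linear functional \<open>K \<rightarrow> F\<close> to the coefficients of a relation over \<open>K\<close>.\<close>

lemma peval_extension_eq_0:
  fixes h :: "'a::field \<Rightarrow> 'k::field"
  assumes h: "field_hom h" and A: "A \<in> carrier_mat m m" and "cyclic_mat A"
    and f: "degree f < m" and eval: "peval (map_mat h A) f = 0\<^sub>m m m"
  shows "f = 0"
proof (rule ccontr)
  interpret field_hom h by fact
  assume "f \<noteq> 0"
  then have "lead_coeff f \<noteq> 0" by simp
  \<comment> \<open>Normalising \<open>\<phi>\<close> at the leading coefficient ensures that the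
    polynomial \<open>g\<close> obtained from \<open>f\<close> is nonzero.\<close>
  from extension_functional[OF h this] obtain \<phi> :: "'k \<Rightarrow> 'a"
    where "(\<forall>y z. \<phi> (y + z) = \<phi> y + \<phi> z) \<and> (\<forall>a y. \<phi> (h a * y) = a * \<phi> y) \<and>
      \<phi> (lead_coeff f) = 1" by (rule exE)
  then have \<phi>: "\<And>y z. \<phi> (y + z) = \<phi> y + \<phi> z" "\<And>a y. \<phi> (h a * y) = a * \<phi> y"
    "\<phi> (lead_coeff f) = 1" by simp_all
  have \<phi>0: "\<phi> 0 = 0" using \<phi>(2)[of 0 0] by simp
  have \<phi>sum: "\<phi> (sum g I) = (\<Sum>i\<in>I. \<phi> (g i))" for g and I :: "nat set"
    by (induction I rule: infinite_finite_induct) (auto simp: \<phi> \<phi>0)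
  have hA: "map_mat h A \<in> carrier_mat m m" using A by simp
  define g where "g = map_poly \<phi> f"
  have coeff_g: "coeff g i = \<phi> (coeff f i)" for i by (simp add: g_def coeff_map_poly \<phi>0)
  have "coeff g (degree f) = 1" by (simp add: coeff_g \<phi>)
  then have "g \<noteq> 0" by auto
  have "degree g \<le> degree f" by (simp add: g_def degree_map_poly_le)
  have "peval A g $$ (k,l) = 0" if kl: "k < m" "l < m" for k l
  proof -
    have "peval A g $$ (k,l) = (\<Sum>i<m. coeff g i * (A ^\<^sub>m i) $$ (k,l))"
      by (rule peval_index[OF A _ kl]) (use f \<open>degree g \<le> degree f\<close> in \<open>auto intro: coeff_eq_0\<close>)
    \<comment> \<open>The entries of the powers of \<open>A\<close> come from the small field, so
      they act as scalars for \<open>\<phi>\<close> and can be moved inside.\<close>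
    also have "\<dots> = (\<Sum>i<m. \<phi> (h ((A ^\<^sub>m i) $$ (k,l)) * coeff f i))"
      by (simp only: \<phi>(2) coeff_g mult.commute[of "\<phi> _"])
    also have "\<dots> = \<phi> (\<Sum>i<m. coeff f i * (map_mat h A ^\<^sub>m i) $$ (k,l))"
      using kl A pow_carrier_mat[OF A]
      by (auto simp: \<phi>sum mat_hom_pow[OF A, symmetric] mult.commute intro!: sum.cong)
    also have "(\<Sum>i<m. coeff f i * (map_mat h A ^\<^sub>m i) $$ (k,l)) = peval (map_mat h A) f $$ (k,l)"
      by (rule peval_index[OF hA _ kl, symmetric]) (use f in \<open>auto intro: coeff_eq_0\<close>)
    finally show ?thesis using kl by (simp add: eval \<phi>0)
  qed
  then have "peval A g = 0\<^sub>m m m" using peval_carrier[OF A, of g] by (intro eq_matI) auto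
  then have "m \<le> degree g" using assms(3) \<open>g \<noteq> 0\<close> cyclic_mat_iff[OF A] by blast
  then show False using f \<open>degree g \<le> degree f\<close> by simp
qed

section \<open>Relations and the span\<close>

text \<open>Division with remainder by the characteristic polynomial: Cayley-Hamilton kills the
  quotient part. This brings all exponents below the size of the matrix.\<close>

lemma pow_mat_eq_peval_mod:
  fixes A :: "'a::field mat"
  assumes A: "A \<in> carrier_mat m m"
  shows "A ^\<^sub>m i = peval A (monom 1 i mod char_poly A)"
proof -
  have P: "peval A f \<in> carrier_mat m m" for f by (rule peval_carrier[OF A])
  have "A ^\<^sub>m i = peval A (char_poly A * (monom 1 i div char_poly A) + monom 1 i mod char_poly A)"
    by (simp add: peval_monom[OF A])
  also have "\<dots> = peval A (monom 1 i mod char_poly A)"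
    unfolding peval_add[OF A] peval_mult[OF A] Cayley_Hamilton[OF A]
    using P by (simp add: left_mult_zero_mat[OF P] left_add_zero_mat[OF P])
  finally show ?thesis .
qed

lemma coeff_mod_char_poly:
  fixes A :: "'a::field mat"
  assumes A: "A \<in> carrier_mat m m" and "i \<ge> m"
  shows "coeff (f mod char_poly A) i = 0"
proof -
  have "char_poly A \<noteq> 0" "degree (char_poly A) = m"
    using degree_monic_char_poly[OF A] by auto
  then show ?thesis using degree_mod_less[of "char_poly A" f] assms(2) by (auto intro: coeff_eq_0)
qed

context
  fixes A B S :: "'a::field mat" and m n :: nat
  assumes A: "A \<in> carrier_mat m m" and B: "B \<in> carrier_mat n n" and S: "S \<in> carrier_mat m n"
begin

private lemma gen_carrier: "A ^\<^sub>m i * S * B ^\<^sub>m j \<in> carrier_mat m n"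
  by (rule mult_carrier_mat[OF mult_carrier_mat[OF pow_carrier_mat[OF A] S] pow_carrier_mat[OF B]])

text \<open>The \<open>m * n\<close> generators with \<open>i < m\<close> and \<open>j < n\<close>
  cannot represent every matrix, since otherwise the span would be everything. They are therefore
  dependent, and the relation is recorded as a polynomial.\<close>

lemma dependent_if_span_neq:
  assumes "mat_span m n {A ^\<^sub>m i * S * B ^\<^sub>m j | i j. True} \<noteq> carrier_mat m n"
  obtains c where "c \<noteq> 0" and "\<And>j. j \<ge> n \<Longrightarrow> coeff c j = 0"
    and "\<And>i j. i \<ge> m \<Longrightarrow> coeff (coeff c j) i = 0" and "bieval A S B c = 0\<^sub>m m n"
proof -
  let ?U = "{A ^\<^sub>m i * S * B ^\<^sub>m j | i j. True}"
  let ?M = "\<lambda>i j k l. (A ^\<^sub>m i * S * B ^\<^sub>m j) $$ (k,l)"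
  interpret vectorspace class_ring "module_mat TYPE('a) m n" by (rule matrix_vs)
  have U: "?U \<subseteq> carrier_mat m n" using gen_carrier by auto
  have neg: "\<not> (\<forall>X. \<exists>c. \<forall>k<m. \<forall>l<n. X k l = (\<Sum>i<m. \<Sum>j<n. c i j * ?M i j k l))"
  proof
    assume *: "\<forall>X. \<exists>c. \<forall>k<m. \<forall>l<n. X k l = (\<Sum>i<m. \<Sum>j<n. c i j * ?M i j k l)"
    have "X \<in> mat_span m n ?U" if X: "X \<in> carrier_mat m n" for X
    proof -
      from *[rule_format, of "\<lambda>k l. X $$ (k,l)"] obtain c where
        c: "\<forall>k<m. \<forall>l<n. X $$ (k,l) = (\<Sum>i<m. \<Sum>j<n. c i j * ?M i j k l)" by (rule exE)
      show ?thesis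
        by (rule sum_in_mat_span[OF U _ _ X, of "{..<m} \<times> {..<n}"
              "\<lambda>(i,j). A ^\<^sub>m i * S * B ^\<^sub>m j" "\<lambda>(i,j). c i j"])
          (use c in \<open>auto simp: sum.cartesian_product case_prod_unfold\<close>)
    qed
    moreover have "mat_span m n ?U \<subseteq> carrier_mat m n"
      using span_is_subset2[of ?U] U by (simp add: module_mat_simps)
    ultimately show False using assms by blast
  qed
  from mp[OF iffD1[OF disj_imp spanning_or_dependent[of m n ?M]] neg] obtain c
    where "(\<exists>i<m. \<exists>j<n. c i j \<noteq> 0) \<and>
      (\<forall>k<m. \<forall>l<n. (\<Sum>i<m. \<Sum>j<n. c i j * ?M i j k l) = 0)" by (rule exE)
  then have c: "\<exists>i<m. \<exists>j<n. c i j \<noteq> 0"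
    "\<And>k l. k < m \<Longrightarrow> l < n \<Longrightarrow> (\<Sum>i<m. \<Sum>j<n. c i j * ?M i j k l) = 0" by simp_all
  \<comment> \<open>The coefficients of the relation are placed at \<open>x^i y^j\<close>, which
    builds in the degree bounds.\<close>
  define C where "C = (\<Sum>j<n. monom (\<Sum>i<m. monom (c i j) i) j)"
  have C: "coeff C j = (if j < n then \<Sum>i<m. monom (c i j) i else 0)" for j
    by (simp add: C_def coeff_sum)
  have C': "coeff (coeff C j) i = (if i < m \<and> j < n then c i j else 0)" for i j
    by (simp add: C coeff_sum)
  have C0: "coeff C j = 0" if "j \<ge> n" for j using that by (simp add: C)
  have C1: "coeff (coeff C j) i = 0" if "i \<ge> m" for i j using that by (simp add: C')
  show thesis
  proof (rule that[OF _ C0 C1])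
    obtain i j where "i < m" "j < n" "c i j \<noteq> 0" using c(1) by blast
    then have "coeff (coeff C j) i \<noteq> 0" by (simp add: C')
    then show "C \<noteq> 0" by auto
    show "bieval A S B C = 0\<^sub>m m n"
    proof (rule eq_matI)
      fix k l assume "k < dim_row (0\<^sub>m m n :: 'a mat)" "l < dim_col (0\<^sub>m m n :: 'a mat)"
      then have kl: "k < m" "l < n" by auto
      have "bieval A S B C $$ (k,l) = (\<Sum>i<m. \<Sum>j<n. coeff (coeff C j) i * ?M i j k l)"
        by (rule bieval_index[OF A B S C1 C0 kl])
      also have "\<dots> = 0" using c(2)[OF kl] by (simp add: C')
      finally show "bieval A S B C $$ (k,l) = 0\<^sub>m m n $$ (k,l)" using kl by simp
    qed (use bieval_carrier[OF A B S, of C] in auto)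
  qed
qed

text \<open>A nonzero relation yields a nonzero functional that kills the generators with small
  exponents. By Cayley-Hamilton it kills all generators, hence every matrix, which fails at a matrix
  unit.\<close>

lemma bieval_eq_0_if_span_eq:
  assumes span: "mat_span m n {A ^\<^sub>m i * S * B ^\<^sub>m j | i j. True} = carrier_mat m n"
    and "\<And>j. j \<ge> n \<Longrightarrow> coeff c j = 0"
    and "\<And>i j. i \<ge> m \<Longrightarrow> coeff (coeff c j) i = 0" and "bieval A S B c = 0\<^sub>m m n"
  shows "c = 0"
proof (rule ccontr)
  let ?M = "\<lambda>i j k l. (A ^\<^sub>m i * S * B ^\<^sub>m j) $$ (k,l)"
  assume "c \<noteq> 0"
  then obtain j where j: "coeff c j \<noteq> 0" by (metis leading_coeff_0_iff)
  then obtain i where i: "coeff (coeff c j) i \<noteq> 0" by (metis leading_coeff_0_iff)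
  have "\<exists>i<m. \<exists>j<n. coeff (coeff c j) i \<noteq> 0"
    using i j assms(2,3) by (metis not_le)
  moreover have "(\<Sum>i<m. \<Sum>j<n. coeff (coeff c j) i * ?M i j k l) = 0" if "k < m" "l < n" for k l
    using bieval_index[OF A B S assms(3,2) that] assms(4) that by simp
  ultimately have "\<exists>y. (\<exists>k<m. \<exists>l<n. y k l \<noteq> 0) \<and>
      (\<forall>i<m. \<forall>j<n. (\<Sum>k<m. \<Sum>l<n. y k l * ?M i j k l) = 0)"
    by (rule dependent_imp_annihilated)
  then obtain y where "(\<exists>k<m. \<exists>l<n. y k l \<noteq> 0) \<and>
      (\<forall>i<m. \<forall>j<n. (\<Sum>k<m. \<Sum>l<n. y k l * ?M i j k l) = 0)" by (rule exE)
  then have y: "\<exists>k<m. \<exists>l<n. y k l \<noteq> 0"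
    "\<And>i j. i < m \<Longrightarrow> j < n \<Longrightarrow> (\<Sum>k<m. \<Sum>l<n. y k l * ?M i j k l) = 0" by simp_all
  define \<psi> where "\<psi> X = (\<Sum>(k,l)\<in>{..<m} \<times> {..<n}. y k l * X $$ (k,l))" for X
  have gen: "\<psi> (A ^\<^sub>m i * S * B ^\<^sub>m j) = 0" for i j
  proof -
    define f where "f = monom 1 i mod char_poly A"
    define g where "g = monom 1 j mod char_poly B"
    have f: "coeff f i = 0" if "i \<ge> m" for i using coeff_mod_char_poly[OF A that] by (simp add: f_def)
    have g: "coeff g j = 0" if "j \<ge> n" for j using coeff_mod_char_poly[OF B that] by (simp add: g_def)
    \<comment> \<open>The product of \<open>f\<close> in the inner and \<open>g\<close> in the outer
      variable: its value is the generator, and its degrees are below \<open>m\<close> and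
      \<open>n\<close>.\<close>
    define d where "d = Polynomial.smult f (map_poly (\<lambda>a. [:a:]) g)"
    have d: "coeff d j = Polynomial.smult (coeff g j) f" for j
      by (simp add: d_def coeff_map_poly)
    have "A ^\<^sub>m i * S * B ^\<^sub>m j = bieval A S B d"
      unfolding d_def bieval_smult[OF A B S] bieval_map_const[OF A B S]
        pow_mat_eq_peval_mod[OF A, of i] pow_mat_eq_peval_mod[OF B, of j] f_def g_def
      by (rule assoc_mult_mat[OF peval_carrier[OF A] S peval_carrier[OF B]])
    then have "\<psi> (A ^\<^sub>m i * S * B ^\<^sub>m j) = (\<Sum>(k,l)\<in>{..<m} \<times> {..<n}. y k l *
        (\<Sum>(i,j)\<in>{..<m} \<times> {..<n}. coeff (coeff d j) i * ?M i j k l))"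
      unfolding \<psi>_def using f g
      by (auto simp: d bieval_index[OF A B S, of m d n] sum.cartesian_product intro!: sum.cong)
    also have "\<dots> = (\<Sum>(i,j)\<in>{..<m} \<times> {..<n}. coeff (coeff d j) i *
        (\<Sum>(k,l)\<in>{..<m} \<times> {..<n}. y k l * ?M i j k l))"
      by (simp add: case_prod_unfold sum_distrib_left mult.left_commute) (rule sum.swap)
    also have "\<dots> = 0"
      using y(2) by (intro sum.neutral) (auto simp: sum.cartesian_product[symmetric])
    finally show ?thesis .
  qed
  have \<psi>: "\<psi> X = 0" if "X \<in> carrier_mat m n" for X
  proof (rule mat_span_subset_kernel[where h = "\<lambda>a. a"])
    show "X \<in> mat_span m n {A ^\<^sub>m i * S * B ^\<^sub>m j | i j. True}" using that span by simp
    show "{A ^\<^sub>m i * S * B ^\<^sub>m j | i j. True} \<subseteq> carrier_mat m n" using gen_carrier by auto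
    show "\<psi> X = 0" if "X \<in> {A ^\<^sub>m i * S * B ^\<^sub>m j | i j. True}" for X using that gen by auto
    show "\<psi> (X + Y) = \<psi> X + \<psi> Y" if "X \<in> carrier_mat m n" "Y \<in> carrier_mat m n" for X Y
      unfolding \<psi>_def sum.distrib[symmetric] using that
      by (intro sum.cong) (auto simp: ring_distribs)
    show "\<psi> (a \<cdot>\<^sub>m X) = a * \<psi> X" if "X \<in> carrier_mat m n" for a X
      unfolding \<psi>_def sum_distrib_left using that by (intro sum.cong) auto
  qed
  from y(1) obtain k l where kl: "k < m" "l < n" "y k l \<noteq> 0" by blast
  \<comment> \<open>The matrix unit at a position where \<open>y\<close> is nonzero detects that
    entry.\<close>
  have "\<psi> (mat m n (\<lambda>x. if x = (k,l) then 1 else 0)) =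
      (\<Sum>x\<in>{..<m} \<times> {..<n}. if x = (k,l) then y k l else 0)"
    unfolding \<psi>_def by (intro sum.cong) (auto split: if_splits)
  also have "\<dots> = y k l" using kl by simp
  finally show False using \<psi>[of "mat m n (\<lambda>x. if x = (k,l) then 1 else 0)"] kl(3) by simp
qed

text \<open>An annihilating polynomial of too small degree is a relation in one variable alone.
  Positivity of the other dimension makes room for exponent 0 in the other variable.\<close>

lemma cyclic_mat_if_span_eq:
  assumes "mat_span m n {A ^\<^sub>m i * S * B ^\<^sub>m j | i j. True} = carrier_mat m n"
    and "m \<ge> 1" and "n \<ge> 1"
  shows "cyclic_mat A" and "cyclic_mat B"
proof -
  have "m \<le> degree q" if q: "q \<noteq> 0" "peval A q = 0\<^sub>m m m" for q
  proof (rule ccontr)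
    assume "\<not> m \<le> degree q"
    then have "[:q:] = 0"
      using assms(2,3) S
      by (intro bieval_eq_0_if_span_eq[OF assms(1)])
        (auto simp: bieval_const[OF A B S] q coeff_pCons coeff_eq_0 left_mult_zero_mat[OF S] split: nat.split)
    then show False using q by simp
  qed
  then show "cyclic_mat A" using cyclic_mat_iff[OF A] by blast
  have "n \<le> degree q" if q: "q \<noteq> 0" "peval B q = 0\<^sub>m n n" for q
  proof (rule ccontr)
    assume "\<not> n \<le> degree q"
    then have "map_poly (\<lambda>a. [:a:]) q = 0"
      using assms(2,3)
      by (intro bieval_eq_0_if_span_eq[OF assms(1)])
        (auto simp: bieval_map_const[OF A B S] q coeff_map_poly coeff_pCons coeff_eq_0
          right_mult_zero_mat[OF S] split: nat.split)
    then have "[:coeff q i:] = 0" for i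
      by (metis coeff_0 coeff_map_poly pCons_0_0)
    then have "q = 0" by (intro poly_eqI) simp
    then show False using q by simp
  qed
  then show "cyclic_mat B" using cyclic_mat_iff[OF B] by blast
qed

end

section \<open>Reduction to a single pair of linear factors\<close>

text \<open>Multiply \<open>c\<close> by the linear factors of \<open>p\<close> one at a time, up to the last step before it
  becomes divisible by \<open>p\<close>.\<close>

lemma linear_factor_descent:
  fixes p :: "'a::field poly" and c :: "'a poly poly"
  assumes "p \<noteq> 0" and dvd: "p dvd (\<Prod>a\<leftarrow>as. [:- a, 1:])" and ndvd: "\<not> [:p:] dvd c"
  obtains a r d t where "p = [:- a, 1:] * r" and "Polynomial.smult d c = Polynomial.smult r t"
    and "map_poly (\<lambda>f. poly f a) t \<noteq> 0"
proof -
  \<comment> \<open>Induction on the list of factors: stop at the first factor that makes the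
    product divisible by \<open>p\<close>, and collect the earlier ones in \<open>d\<close>.\<close>
  have "\<exists>a d. \<not> [:p:] dvd Polynomial.smult d c \<and> [:p:] dvd Polynomial.smult ([:- a, 1:] * d) c"
    if "\<not> [:p:] dvd c" "[:p:] dvd Polynomial.smult (\<Prod>a\<leftarrow>as. [:- a, 1:]) c" for as c
    using that
  proof (induction as arbitrary: c)
    case Nil
    then show ?case by simp
  next
    case (Cons a as)
    show ?case
    proof (cases "[:p:] dvd Polynomial.smult [:- a, 1:] c")
      case True
      then show ?thesis using Cons.prems(1) by (intro exI[of _ a] exI[of _ 1]) simp
    next
      case False
      have "[:p:] dvd Polynomial.smult (\<Prod>a\<leftarrow>as. [:- a, 1:]) (Polynomial.smult [:- a, 1:] c)"
        using Cons.prems(2) by (simp add: mult.commute del: mult_pCons_left mult_pCons_right)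
      from Cons.IH[OF False this] obtain b d where
        *: "\<not> [:p:] dvd Polynomial.smult d (Polynomial.smult [:- a, 1:] c)"
          "[:p:] dvd Polynomial.smult ([:- b, 1:] * d) (Polynomial.smult [:- a, 1:] c)" by blast
      show ?thesis
        by (rule exI[of _ b], rule exI[of _ "d * [:- a, 1:]"])
          (use * in \<open>simp only: smult_smult mult.assoc not_False_eq_True simp_thms\<close>)
    qed
  qed
  moreover have "[:p:] dvd Polynomial.smult (\<Prod>a\<leftarrow>as. [:- a, 1:]) c"
    using dvd by (simp add: const_poly_dvd_iff)
  ultimately obtain a d where ad: "\<not> [:p:] dvd Polynomial.smult d c"
    "[:p:] dvd Polynomial.smult ([:- a, 1:] * d) c" using ndvd by blast
  \<comment> \<open>Otherwise \<open>x - a\<close> would be invertible modulo \<open>p\<close> and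
    could be cancelled, so \<open>d\<close> times \<open>c\<close> would already be divisible. The
    identity \<open>w\<close> below is the explicit Bezout relation.\<close>
  have "[:- a, 1:] dvd p"
  proof (rule ccontr)
    assume "\<not> [:- a, 1:] dvd p"
    then have pa: "poly p a \<noteq> 0" by (simp add: poly_eq_0_iff_dvd)
    have "[:- a, 1:] dvd p - [:poly p a:]" by (simp add: poly_eq_0_iff_dvd[symmetric])
    then obtain w where "p - [:poly p a:] = [:- a, 1:] * w" by (elim dvdE)
    then have w: "[:poly p a:] = p - [:- a, 1:] * w" by (simp add: algebra_simps)
    have cancel: "p dvd f" if "p dvd [:- a, 1:] * f" for f
    proof -
      have "Polynomial.smult (poly p a) f = (p - [:- a, 1:] * w) * f" unfolding w[symmetric] by simp
      also have "\<dots> = p * f - w * ([:- a, 1:] * f)"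
        by (simp add: right_diff_distrib ac_simps del: mult_pCons_left mult_pCons_right)
      finally have "p dvd Polynomial.smult (poly p a) f"
        using that by (simp only: dvd_diff dvd_mult dvd_triv_left)
      then show ?thesis using pa by (simp add: dvd_smult_iff)
    qed
    have "p dvd [:- a, 1:] * (d * coeff c j)" for j
      using ad(2) by (simp only: const_poly_dvd_iff coeff_smult mult.assoc)
    then have "[:p:] dvd Polynomial.smult d c"
      unfolding const_poly_dvd_iff coeff_smult using cancel by blast
    then show False using ad(1) by contradiction
  qed
  then obtain r where r: "p = [:- a, 1:] * r" by (elim dvdE)
  from ad(2) obtain t where "Polynomial.smult ([:- a, 1:] * d) c = [:p:] * t" by (elim dvdE)
  then have "Polynomial.smult ([:- a, 1:] * d) c = Polynomial.smult p t"
    by (simp del: mult_pCons_left mult_pCons_right add: mult_pCons_left[of p 0 t])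
  then have "Polynomial.smult [:- a, 1:] (Polynomial.smult d c) = Polynomial.smult [:- a, 1:] (Polynomial.smult r t)"
    by (simp only: r smult_smult)
  then have t: "Polynomial.smult d c = Polynomial.smult r t"
    by (metis smult_cancel pCons_eq_0_iff zero_neq_one)
  show thesis
  proof (rule that[OF r t])
    \<comment> \<open>If every coefficient of \<open>t\<close> vanished at \<open>a\<close>, then
      \<open>x - a\<close> would divide them all and \<open>p = (x - a) r\<close> would divide
      \<open>r\<close> times \<open>t\<close>.\<close>
    show "map_poly (\<lambda>f. poly f a) t \<noteq> 0"
    proof
      assume *: "map_poly (\<lambda>f. poly f a) t = 0"
      have "[:- a, 1:] dvd coeff t j" for j
        using arg_cong[OF *, of "\<lambda>q. coeff q j"] by (simp add: coeff_map_poly poly_eq_0_iff_dvd)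
      then have "p dvd r * coeff t j" for j
        unfolding r mult.commute[of _ r] by (intro mult_dvd_mono dvd_refl)
      then have "[:p:] dvd Polynomial.smult r t" by (simp add: const_poly_dvd_iff)
      then show False using ad(1) t by simp
    qed
  qed
qed

text \<open>Each coefficient \<open>f\<close> differs from its value \<open>f(a)\<close> by a
  multiple of \<open>x - a\<close>.\<close>

lemma residue_decomposition:
  fixes t :: "'a::field poly poly"
  obtains w where "t = map_poly (\<lambda>a. [:a:]) (map_poly (\<lambda>f. poly f a) t) + Polynomial.smult [:- a, 1:] w"
proof -
  have "[:[:- a, 1:]:] dvd t - map_poly (\<lambda>a. [:a:]) (map_poly (\<lambda>f. poly f a) t)"
    by (simp add: const_poly_dvd_iff poly_eq_0_iff_dvd[symmetric] coeff_map_poly)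
  then obtain w where "t - map_poly (\<lambda>a. [:a:]) (map_poly (\<lambda>f. poly f a) t) = [:[:- a, 1:]:] * w"
    by (elim dvdE)
  then show thesis by (intro that[of w]) (simp add: algebra_simps)
qed

text \<open>The descent runs first in \<open>x\<close>, leaving \<open>r(x) e(y)\<close> as a
  relation, and then in \<open>y\<close>, turning \<open>e\<close> into a nonzero multiple of
  \<open>s\<close> modulo the characteristic polynomial of \<open>B\<close>.\<close>

lemma factor_relation:
  fixes A B S :: "'a::field mat"
  assumes A: "A \<in> carrier_mat m m" and B: "B \<in> carrier_mat n n" and S: "S \<in> carrier_mat m n"
    and "char_poly A dvd (\<Prod>a\<leftarrow>as. [:- a, 1:])" and "char_poly B dvd (\<Prod>b\<leftarrow>bs. [:- b, 1:])"
    and "c \<noteq> 0" and cn: "\<And>j. j \<ge> n \<Longrightarrow> coeff c j = 0"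
    and cm: "\<And>i j. i \<ge> m \<Longrightarrow> coeff (coeff c j) i = 0" and c: "bieval A S B c = 0\<^sub>m m n"
  obtains a r b s where "char_poly A = [:- a, 1:] * r" and "char_poly B = [:- b, 1:] * s"
    and "peval A r * S * peval B s = 0\<^sub>m m n"
proof -
  have pA: "char_poly A \<noteq> 0" "degree (char_poly A) = m"
    and pB: "char_poly B \<noteq> 0" "degree (char_poly B) = n"
    using degree_monic_char_poly[OF A] degree_monic_char_poly[OF B] by auto
  have not_dvd: "\<not> p dvd f" if "f \<noteq> 0" "\<And>i. i \<ge> degree p \<Longrightarrow> coeff f i = 0" for p f :: "'a poly"
  proof
    assume "p dvd f"
    then have "degree p \<le> degree f" using \<open>f \<noteq> 0\<close> by (rule dvd_imp_degree_le)
    then show False using that leading_coeff_0_iff by blast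
  qed
  obtain j where "coeff c j \<noteq> 0" using \<open>c \<noteq> 0\<close> by (metis leading_coeff_0_iff)
  \<comment> \<open>A nonzero coefficient has degree below \<open>m\<close>, the degree of the
    characteristic polynomial.\<close>
  then have "\<not> [:char_poly A:] dvd c"
    using not_dvd[of "coeff c j" "char_poly A"] cm pA by (auto simp: const_poly_dvd_iff)
  from linear_factor_descent[OF pA(1) assms(4) this] obtain a r d t where
    r: "char_poly A = [:- a, 1:] * r" and t: "Polynomial.smult d c = Polynomial.smult r t"
    and "map_poly (\<lambda>f. poly f a) t \<noteq> 0" .
  define e where "e = map_poly (\<lambda>f. poly f a) t"
  have "e \<noteq> 0" unfolding e_def by fact
  have "r \<noteq> 0" using pA r by auto
  have e: "coeff e j = 0" if "j \<ge> n" for j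
  proof -
    have "r * coeff t j = d * coeff c j" using arg_cong[OF t, of "\<lambda>q. coeff q j"] by simp
    then have "coeff t j = 0" using cn[OF that] \<open>r \<noteq> 0\<close> by simp
    then show ?thesis by (simp add: e_def coeff_map_poly)
  qed
  have R: "peval A r \<in> carrier_mat m m" and E: "peval B e \<in> carrier_mat n n"
    using peval_carrier A B by auto
  define T where "T = peval A r * S"
  have T: "T \<in> carrier_mat m n" unfolding T_def using R S by (rule mult_carrier_mat)
  \<comment> \<open>Write \<open>t\<close> as its residue \<open>e\<close> plus a multiple of
    \<open>x - a\<close>. Multiplied by \<open>r\<close>, the second part becomes a multiple of the
    characteristic polynomial and vanishes at \<open>A\<close>.\<close>
  have TE: "T * peval B e = 0\<^sub>m m n"
  proof -
    obtain w where w: "t = map_poly (\<lambda>a. [:a:]) e + Polynomial.smult [:- a, 1:] w"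
      unfolding e_def by (rule residue_decomposition)
    have W: "bieval A S B w \<in> carrier_mat m n" by (rule bieval_carrier[OF A B S])
    have "0\<^sub>m m n = bieval A S B (Polynomial.smult d c)"
      using right_mult_zero_mat[OF peval_carrier[OF A]] by (simp add: bieval_smult[OF A B S] c)
    also have "\<dots> = bieval A S B (Polynomial.smult r (map_poly (\<lambda>a. [:a:]) e) + Polynomial.smult (char_poly A) w)"
      by (simp add: t w r smult_add_right mult.commute[of r] del: mult_pCons_left mult_pCons_right)
    also have "\<dots> = peval A r * (S * peval B e) + 0\<^sub>m m n"
      by (simp add: bieval_add[OF A B S] bieval_smult[OF A B S] bieval_map_const[OF A B S]
          Cayley_Hamilton[OF A] left_mult_zero_mat[OF W])
    also have "\<dots> = T * peval B e"
      unfolding T_def using assoc_mult_mat[OF R S E] R S E by simp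
    finally show ?thesis by simp
  qed
  \<comment> \<open>As the constant \<open>[:e:]\<close>, the polynomial \<open>e\<close> has its
    variable on the inner level, so the same descent applies to \<open>B\<close>.\<close>
  have "\<not> [:char_poly B:] dvd [:e:]"
    using not_dvd[of e "char_poly B"] e pB \<open>e \<noteq> 0\<close> by auto
  from linear_factor_descent[OF pB(1) assms(5) this] obtain b s d' t' where
    s: "char_poly B = [:- b, 1:] * s" and t': "Polynomial.smult d' [:e:] = Polynomial.smult s t'"
    and t'0: "map_poly (\<lambda>f. poly f b) t' \<noteq> 0" .
  have "s \<noteq> 0" using pB s by auto
  have coeff_t': "s * coeff t' j = (if j = 0 then d' * e else 0)" for j
    using arg_cong[OF t', of "\<lambda>q. coeff q j"] by (simp add: coeff_pCons split: nat.splits)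
  \<comment> \<open>Only the constant coefficient of \<open>t'\<close> can be nonzero, so its
    residue at \<open>b\<close> is the single scalar \<open>x\<close> defined next.\<close>
  have "poly (coeff t' 0) b \<noteq> 0"
  proof
    assume "poly (coeff t' 0) b = 0"
    moreover have "coeff t' j = 0" if "j \<noteq> 0" for j using coeff_t'[of j] that \<open>s \<noteq> 0\<close> by simp
    ultimately have "poly (coeff t' j) b = 0" for j by (cases "j = 0") auto
    then have "map_poly (\<lambda>f. poly f b) t' = 0" by (intro poly_eqI) (simp add: coeff_map_poly)
    then show False using t'0 by simp
  qed
  define x where "x = poly (coeff t' 0) b"
  have "x \<noteq> 0" unfolding x_def by fact
  have P: "peval B s \<in> carrier_mat n n" "peval B d' \<in> carrier_mat n n" using peval_carrier B by auto
  have "[:- b, 1:] dvd coeff t' 0 - [:x:]" by (simp add: poly_eq_0_iff_dvd[symmetric] x_def)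
  then obtain w where "coeff t' 0 - [:x:] = [:- b, 1:] * w" by (elim dvdE)
  then have w: "coeff t' 0 = [:x:] + [:- b, 1:] * w" by (metis diff_add_cancel add.commute)
  have "e * d' = s * ([:x:] + [:- b, 1:] * w)" using coeff_t'[of 0] unfolding w by (simp add: mult.commute)
  \<comment> \<open>Thus \<open>e d'\<close> is \<open>x s\<close> modulo the characteristic
    polynomial of \<open>B\<close>. Multiplying the relation for \<open>e\<close> by the value of
    \<open>d'\<close> gives the relation for \<open>s\<close>.\<close>
  also have "\<dots> = Polynomial.smult x s + char_poly B * w"
    unfolding s ring_distribs(1) by (simp add: ac_simps del: mult_pCons_left mult_pCons_right) (simp add: mult.commute)
  finally have "peval B e * peval B d' = x \<cdot>\<^sub>m peval B s"
    using P peval_mult[OF B, of e d'] left_mult_zero_mat[OF peval_carrier[OF B, of w]]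
    by (simp add: peval_add[OF B] peval_smult[OF B] peval_mult[OF B, of "char_poly B"] Cayley_Hamilton[OF B])
  then have "x \<cdot>\<^sub>m (T * peval B s) = T * (peval B e * peval B d')"
    using mult_smult_distrib[OF T P(1)] by simp
  also have "\<dots> = 0\<^sub>m m n"
    using assoc_mult_mat[OF T E P(2)] left_mult_zero_mat[OF P(2)] by (simp add: TE)
  finally have *: "x \<cdot>\<^sub>m (T * peval B s) = 0\<^sub>m m n" .
  have "T * peval B s = 0\<^sub>m m n"
  proof (rule eq_matI)
    fix k l assume "k < dim_row (0\<^sub>m m n :: 'a mat)" "l < dim_col (0\<^sub>m m n :: 'a mat)"
    then have kl: "k < m" "l < n" by auto
    have TP: "T * peval B s \<in> carrier_mat m n" using T P(1) by (rule mult_carrier_mat)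
    have "x * (T * peval B s) $$ (k,l) = 0"
      using arg_cong[OF *, of "\<lambda>X. X $$ (k,l)"] kl TP by (simp del: index_mult_mat)
    then show "(T * peval B s) $$ (k,l) = 0\<^sub>m m n $$ (k,l)" using \<open>x \<noteq> 0\<close> kl by simp
  qed (use T P(1) in auto)
  then show thesis using r s unfolding T_def by (intro that[of a r b s])
qed

section \<open>Eigenvectors\<close>

text \<open>The row equation is the transposed column equation, which reduces left eigenvectors to
  right ones.\<close>

lemma left_eigenvec_iff:
  fixes A :: "'k::field mat"
  assumes A: "A \<in> carrier_mat m m"
  shows "left_eigenvec A u \<longleftrightarrow> (\<exists>c. poly (char_poly A) c = 0 \<and> eigenvector A\<^sup>T u c)"
proof -
  have "mat_of_row u * A = c \<cdot>\<^sub>m mat_of_row u \<longleftrightarrow> A\<^sup>T *\<^sub>v u = c \<cdot>\<^sub>v u" if u: "u \<in> carrier_vec m" for c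
  proof -
    have "(mat_of_row u * A) $$ (0,j) = (A\<^sup>T *\<^sub>v u) $ j" if "j < m" for j
      using A u that by (simp add: comm_scalar_prod[of u m])
    moreover have "mat_of_row u * A = c \<cdot>\<^sub>m mat_of_row u \<longleftrightarrow>
        (\<forall>j<m. (mat_of_row u * A) $$ (0,j) = c * u $ j)"
      using A u by (auto simp: mat_eq_iff simp del: index_mult_mat(1))
    moreover have "A\<^sup>T *\<^sub>v u = c \<cdot>\<^sub>v u \<longleftrightarrow> (\<forall>j<m. (A\<^sup>T *\<^sub>v u) $ j = c * u $ j)"
      using A u by (auto simp: vec_eq_iff simp del: index_mult_mat_vec)
    ultimately show ?thesis by simp
  qed
  then show ?thesis using A by (auto simp: left_eigenvec_def eigenvector_def)
qed

text \<open>By Cayley-Hamilton \<open>(B - b I) s(B) = 0\<close>, so every column of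
  \<open>s(B)\<close> satisfies the eigenvalue equation for \<open>b\<close>.\<close>

lemma right_eigenvec_col:
  fixes B :: "'k::field mat"
  assumes B: "B \<in> carrier_mat n n" and s: "char_poly B = [:- b, 1:] * s"
    and l: "l < n" "col (peval B s) l \<noteq> 0\<^sub>v n"
  shows "right_eigenvec B (col (peval B s) l)"
proof -
  have P: "peval B s \<in> carrier_mat n n" by (rule peval_carrier[OF B])
  have BP: "B * peval B s = b \<cdot>\<^sub>m peval B s"
  proof -
    have "B * peval B s = peval B (monom 1 1 * s)"
      using B by (simp add: peval_mult[OF B] peval_monom[OF B] del: One_nat_def) simp
    also have "monom 1 1 * s = char_poly B + Polynomial.smult b s"
      unfolding s by (simp add: monom_altdef)
    finally show ?thesis
      using P by (simp add: peval_add[OF B] peval_smult[OF B] Cayley_Hamilton[OF B])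
  qed
  have "B *\<^sub>v col (peval B s) l = col (B * peval B s) l"
    using col_mult2[OF B P l(1)] by simp
  then have "B *\<^sub>v col (peval B s) l = b \<cdot>\<^sub>v col (peval B s) l"
    unfolding BP using P l by simp
  moreover have "poly (char_poly B) b = 0" by (simp add: s)
  ultimately show ?thesis
    using B P l by (auto simp: right_eigenvec_def eigenvector_def)
qed

lemma peval_transpose:
  assumes A: "A \<in> carrier_mat m m"
  shows "peval A\<^sup>T f = (peval A f)\<^sup>T"
proof (induction f)
  case 0
  then show ?case using A by (simp add: peval_zero[of _ m])
next
  case (pCons a f)
  have AT: "A\<^sup>T \<in> carrier_mat m m" and P: "peval A f \<in> carrier_mat m m"
    using A peval_carrier by auto
  have "(peval A f)\<^sup>T * A\<^sup>T = (peval A f * A)\<^sup>T"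
    unfolding transpose_mult[OF A P, symmetric]
    using peval_mult_commute[OF A, of "[:0,1:]" f] by (simp add: peval_X[OF A])
  moreover have "peval A f * A \<in> carrier_mat m m" using A P by simp
  ultimately show ?case
    unfolding peval_pCons[OF A] peval_pCons[OF AT] pCons.IH
    by (intro eq_matI) (auto simp del: index_mult_mat)
qed

lemma left_eigenvec_row:
  fixes A :: "'k::field mat"
  assumes A: "A \<in> carrier_mat m m" and r: "char_poly A = [:- a, 1:] * r"
    and k: "k < m" "row (peval A r) k \<noteq> 0\<^sub>v m"
  shows "left_eigenvec A (row (peval A r) k)"
proof -
  have AT: "A\<^sup>T \<in> carrier_mat m m" using A by simp
  have "col (peval A\<^sup>T r) k = row (peval A r) k"
    using k(1) peval_carrier[OF A, of r] by (simp add: peval_transpose[OF A])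
  moreover have "char_poly A\<^sup>T = char_poly A" by (rule char_poly_transpose_mat[OF A])
  ultimately show ?thesis
    using right_eigenvec_col[OF AT, of a r k] r k
    by (simp add: left_eigenvec_iff[OF A] right_eigenvec_def)
qed

section \<open>Necessity of the pairing condition\<close>

lemma eigenvectors_sandwich:
  fixes A B S :: "'k::field mat"
  assumes A: "A \<in> carrier_mat m m" and B: "B \<in> carrier_mat n n" and S: "S \<in> carrier_mat m n"
    and u: "eigenvector A\<^sup>T u a" and v: "eigenvector B v b"
  shows "u \<bullet> ((A ^\<^sub>m i * S * B ^\<^sub>m j) *\<^sub>v v) = a ^ i * b ^ j * (u \<bullet> (S *\<^sub>v v))"
proof -
  have u': "u \<in> carrier_vec m" and v': "v \<in> carrier_vec n"
    using u v A B by (auto simp: eigenvector_def)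
  have left: "u \<bullet> (A ^\<^sub>m i *\<^sub>v x) = a ^ i * (u \<bullet> x)" if x: "x \<in> carrier_vec m" for x
    using x
  proof (induction i arbitrary: x)
    case 0
    then show ?case using A by simp
  next
    case (Suc i)
    have Ax: "A *\<^sub>v x \<in> carrier_vec m" using A Suc.prems by simp
    have "u \<bullet> (A *\<^sub>v x) = (A\<^sup>T *\<^sub>v u) \<bullet> x"
      by (rule transpose_vec_mult_scalar[OF A Suc.prems u', symmetric])
    also have "\<dots> = a * (u \<bullet> x)"
      using u u' Suc.prems by (simp add: eigenvector_def)
    finally show ?case
      using Suc.IH[OF Ax] assoc_mult_mat_vec[OF pow_carrier_mat[OF A, of i] A Suc.prems] by simp
  qed
  have Ai: "A ^\<^sub>m i \<in> carrier_mat m m" and Bj: "B ^\<^sub>m j \<in> carrier_mat n n"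
    using pow_carrier_mat[OF A] pow_carrier_mat[OF B] by auto
  have AS: "A ^\<^sub>m i * S \<in> carrier_mat m n" using Ai S by (rule mult_carrier_mat)
  have Sv: "S *\<^sub>v v \<in> carrier_vec m" using S v' by simp
  have Bv: "B ^\<^sub>m j *\<^sub>v v = b ^ j \<cdot>\<^sub>v v" by (rule eigenvector_pow[OF B v])
  have "(A ^\<^sub>m i * S * B ^\<^sub>m j) *\<^sub>v v = A ^\<^sub>m i *\<^sub>v (S *\<^sub>v (b ^ j \<cdot>\<^sub>v v))"
    using v' by (simp add: assoc_mult_mat_vec[OF AS Bj v'] Bv assoc_mult_mat_vec[OF Ai S])
  also have "\<dots> = A ^\<^sub>m i *\<^sub>v (b ^ j \<cdot>\<^sub>v (S *\<^sub>v v))"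
    by (simp add: mult_mat_vec[OF S v'])
  finally show ?thesis
    using Sv u' by (simp add: left)
qed

text \<open>If the pairing vanished, the additive map \<open>X \<mapsto> u h(X) v\<close> would kill
  all generators and hence all matrices. A matrix unit at nonzero entries of \<open>u\<close> and
  \<open>v\<close> contradicts this.\<close>

lemma eigenvector_pairing_if_span_eq:
  fixes A B S :: "'a::field mat" and h :: "'a \<Rightarrow> 'k::field"
  assumes A: "A \<in> carrier_mat m m" and B: "B \<in> carrier_mat n n" and S: "S \<in> carrier_mat m n"
    and h: "field_hom h"
    and span: "mat_span m n {A ^\<^sub>m i * S * B ^\<^sub>m j | i j. True} = carrier_mat m n"
    and u: "left_eigenvec (map_mat h A) u" and v: "right_eigenvec (map_mat h B) v"
  shows "u \<bullet> (map_mat h S *\<^sub>v v) \<noteq> 0"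
proof
  interpret field_hom h by fact
  assume uSv: "u \<bullet> (map_mat h S *\<^sub>v v) = 0"
  have hA: "map_mat h A \<in> carrier_mat m m" and hB: "map_mat h B \<in> carrier_mat n n"
    and hS: "map_mat h S \<in> carrier_mat m n" using A B S by auto
  obtain a where ua: "eigenvector (map_mat h A)\<^sup>T u a" using u left_eigenvec_iff[OF hA] by auto
  obtain b where vb: "eigenvector (map_mat h B) v b" using v by (auto simp: right_eigenvec_def)
  have u': "u \<in> carrier_vec m" "u \<noteq> 0\<^sub>v m" and v': "v \<in> carrier_vec n" "v \<noteq> 0\<^sub>v n"
    using ua vb A B by (auto simp: eigenvector_def)
  have Ai: "A ^\<^sub>m i \<in> carrier_mat m m" and Bj: "B ^\<^sub>m j \<in> carrier_mat n n" for i j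
    using pow_carrier_mat[OF A] pow_carrier_mat[OF B] by auto
  have AS: "A ^\<^sub>m i * S \<in> carrier_mat m n" for i using Ai S by (rule mult_carrier_mat)
  have ASB: "A ^\<^sub>m i * S * B ^\<^sub>m j \<in> carrier_mat m n" for i j using AS Bj by (rule mult_carrier_mat)
  have zero: "u \<bullet> (map_mat h X *\<^sub>v v) = 0" if X: "X \<in> carrier_mat m n" for X
  proof (rule mat_span_subset_kernel[where \<psi> = "\<lambda>X. u \<bullet> (map_mat h X *\<^sub>v v)" and h = h])
    show "{A ^\<^sub>m i * S * B ^\<^sub>m j | i j. True} \<subseteq> carrier_mat m n" using ASB by auto
    show "X \<in> mat_span m n {A ^\<^sub>m i * S * B ^\<^sub>m j | i j. True}" using X span by simp
  next
    fix X assume "X \<in> {A ^\<^sub>m i * S * B ^\<^sub>m j | i j. True}"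
    then obtain i j where X: "X = A ^\<^sub>m i * S * B ^\<^sub>m j" by auto
    have "map_mat h X = map_mat h A ^\<^sub>m i * map_mat h S * map_mat h B ^\<^sub>m j"
      unfolding X by (simp add: mat_hom_mult[OF AS Bj] mat_hom_mult[OF Ai S] mat_hom_pow[OF A] mat_hom_pow[OF B])
    then show "u \<bullet> (map_mat h X *\<^sub>v v) = 0"
      by (simp add: eigenvectors_sandwich[OF hA hB hS ua vb] uSv)
  next
    fix X Y :: "'a mat" assume XY: "X \<in> carrier_mat m n" "Y \<in> carrier_mat m n"
    have hXY: "map_mat h X \<in> carrier_mat m n" "map_mat h Y \<in> carrier_mat m n" using XY by auto
    have "map_mat h (X + Y) = map_mat h X + map_mat h Y"
      using XY by (intro eq_matI) (auto simp: hom_add)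
    then show "u \<bullet> (map_mat h (X + Y) *\<^sub>v v) = u \<bullet> (map_mat h X *\<^sub>v v) + u \<bullet> (map_mat h Y *\<^sub>v v)"
      using add_mult_distrib_mat_vec[OF hXY v'(1)] hXY v' u'
      by (simp add: scalar_prod_add_distrib[of u m])
  next
    fix a and X :: "'a mat" assume X: "X \<in> carrier_mat m n"
    have "map_mat h (a \<cdot>\<^sub>m X) *\<^sub>v v = h a \<cdot>\<^sub>v (map_mat h X *\<^sub>v v)"
      using X v' by (intro eq_vecI) (auto simp: scalar_prod_def hom_mult sum_distrib_left mult.assoc)
    then show "u \<bullet> (map_mat h (a \<cdot>\<^sub>m X) *\<^sub>v v) = h a * (u \<bullet> (map_mat h X *\<^sub>v v))"
      using X v' u' by simp
  qed
  obtain k where k: "k < m" "u $ k \<noteq> 0" using u' by (metis carrier_vecD eq_vecI index_zero_vec)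
  obtain l where l: "l < n" "v $ l \<noteq> 0" using v' by (metis carrier_vecD eq_vecI index_zero_vec)
  define E where "E = mat m n (\<lambda>(i,j). if i = k \<and> j = l then 1 else (0::'a))"
  have "map_mat h E *\<^sub>v v = v $ l \<cdot>\<^sub>v unit_vec m k"
  proof (rule eq_vecI)
    fix i assume "i < dim_vec (v $ l \<cdot>\<^sub>v unit_vec m k)"
    then have i: "i < m" by simp
    have "(map_mat h E *\<^sub>v v) $ i = (\<Sum>j<n. map_mat h E $$ (i,j) * v $ j)"
      using i v' by (simp add: E_def scalar_prod_def atLeast0LessThan)
    also have "\<dots> = (\<Sum>j<n. if j = l then (if i = k then v $ l else 0) else 0)"
      using i by (intro sum.cong refl) (simp add: E_def)
    finally show "(map_mat h E *\<^sub>v v) $ i = (v $ l \<cdot>\<^sub>v unit_vec m k) $ i"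
      using i l k by simp
  qed (simp add: E_def)
  then have "u \<bullet> (map_mat h E *\<^sub>v v) = v $ l * u $ k"
    using u' k by simp
  moreover have "E \<in> carrier_mat m n" by (simp add: E_def)
  ultimately show False using zero[of E] k l by simp
qed

section \<open>Sufficiency over a field in which both polynomials split\<close>

lemma map_char_poly_dvd_if_splits:
  fixes A :: "'a::field mat" and h :: "'a \<Rightarrow> 'k::field"
  assumes "field_hom h" and A: "A \<in> carrier_mat m m" and "splits_under h (char_poly A)"
  obtains as where "char_poly (map_mat h A) dvd (\<Prod>a\<leftarrow>as. [:- a, 1:])"
proof -
  interpret field_hom h by fact
  from assms(3) obtain c as where c: "map_poly h (char_poly A) = Polynomial.smult c (\<Prod>a\<leftarrow>as. [:- a, 1:])"
    by (auto simp: splits_under_def)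
  have hA: "map_mat h A \<in> carrier_mat m m" using A by simp
  have "char_poly (map_mat h A) \<noteq> 0" using degree_monic_char_poly[OF hA] by auto
  then have "c \<noteq> 0" using c by (auto simp: char_poly_hom[OF A])
  then show thesis
    by (intro that[of as]) (simp add: char_poly_hom[OF A] c smult_dvd_iff)
qed

text \<open>Removing a linear factor leaves \<open>r\<close> nonzero of degree below
  \<open>m\<close>, and no such polynomial annihilates a cyclic matrix, even over the
  extension.\<close>

lemma peval_cofactor_neq_0:
  fixes A :: "'a::field mat" and h :: "'a \<Rightarrow> 'k::field"
  assumes "field_hom h" and A: "A \<in> carrier_mat m m" and "cyclic_mat A"
    and r: "char_poly (map_mat h A) = [:- a, 1:] * r"
  shows "peval (map_mat h A) r \<noteq> 0\<^sub>m m m"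
proof
  assume "peval (map_mat h A) r = 0\<^sub>m m m"
  have hA: "map_mat h A \<in> carrier_mat m m" using A by simp
  have "char_poly (map_mat h A) \<noteq> 0" "degree (char_poly (map_mat h A)) = m"
    using degree_monic_char_poly[OF hA] by auto
  moreover from this have "r \<noteq> 0" using r by auto
  ultimately have "degree r < m"
    unfolding r by (subst (asm) degree_mult_eq) auto
  then show False
    using peval_extension_eq_0[OF assms(1) A assms(3)] \<open>peval (map_mat h A) r = 0\<^sub>m m m\<close> \<open>r \<noteq> 0\<close> by blast
qed

text \<open>A relation over the small field is carried to the extension and reduced to
  \<open>R S Q = 0\<close> with nonzero cofactor values \<open>R\<close> and \<open>Q\<close>. A
  nonzero row of \<open>R\<close> and a nonzero column of \<open>Q\<close> are eigenvectors whose
  pairing vanishes.\<close>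

lemma span_eq_if_eigenvector_pairing:
  fixes A B S :: "'a::field mat" and h :: "'a \<Rightarrow> 'k::field"
  assumes A: "A \<in> carrier_mat m m" and B: "B \<in> carrier_mat n n" and S: "S \<in> carrier_mat m n"
    and h: "field_hom h"
    and splits: "splits_under h (char_poly A)" "splits_under h (char_poly B)"
    and cyclic: "cyclic_mat A" "cyclic_mat B"
    and pairing: "\<And>u v. left_eigenvec (map_mat h A) u \<Longrightarrow> right_eigenvec (map_mat h B) v \<Longrightarrow>
      u \<bullet> (map_mat h S *\<^sub>v v) \<noteq> 0"
  shows "mat_span m n {A ^\<^sub>m i * S * B ^\<^sub>m j | i j. True} = carrier_mat m n"
proof (rule ccontr)
  interpret field_hom h by fact
  assume "mat_span m n {A ^\<^sub>m i * S * B ^\<^sub>m j | i j. True} \<noteq> carrier_mat m n"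
  from dependent_if_span_neq[OF A B S this] obtain c where
    c: "c \<noteq> 0" "\<And>j. j \<ge> n \<Longrightarrow> coeff c j = 0" "\<And>i j. i \<ge> m \<Longrightarrow> coeff (coeff c j) i = 0"
      "bieval A S B c = 0\<^sub>m m n" by metis
  have hA: "map_mat h A \<in> carrier_mat m m" and hB: "map_mat h B \<in> carrier_mat n n"
    and hS: "map_mat h S \<in> carrier_mat m n" using A B S by auto
  define d where "d = map_poly (map_poly h) c"
  have coeff_d: "coeff d j = map_poly h (coeff c j)" for j by (simp add: d_def coeff_map_poly)
  obtain j where "coeff c j \<noteq> 0" using c(1) by (metis leading_coeff_0_iff)
  \<comment> \<open>Field homomorphisms are injective, so the relation stays nonzero.\<close>
  then have "coeff d j \<noteq> 0" by (simp add: coeff_d)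
  then have d: "d \<noteq> 0" by auto
  have dn: "coeff d j = 0" if "j \<ge> n" for j using c(2)[OF that] by (simp add: coeff_d)
  have dm: "coeff (coeff d j) i = 0" if "i \<ge> m" for i j using c(3)[OF that] by (simp add: coeff_d)
  have ed: "bieval (map_mat h A) (map_mat h S) (map_mat h B) d = 0\<^sub>m m n"
    unfolding d_def bieval_hom[OF h A B S] c(4) by (intro eq_matI) auto
  obtain as where as: "char_poly (map_mat h A) dvd (\<Prod>a\<leftarrow>as. [:- a, 1:])"
    using map_char_poly_dvd_if_splits[OF h A splits(1)] .
  obtain bs where bs: "char_poly (map_mat h B) dvd (\<Prod>b\<leftarrow>bs. [:- b, 1:])"
    using map_char_poly_dvd_if_splits[OF h B splits(2)] .
  from factor_relation[OF hA hB hS as bs d dn dm ed] obtain a r b s where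
    r: "char_poly (map_mat h A) = [:- a, 1:] * r" and s: "char_poly (map_mat h B) = [:- b, 1:] * s"
    and rel: "peval (map_mat h A) r * map_mat h S * peval (map_mat h B) s = 0\<^sub>m m n" by metis
  define R where "R = peval (map_mat h A) r"
  define Q where "Q = peval (map_mat h B) s"
  have R: "R \<in> carrier_mat m m" and Q: "Q \<in> carrier_mat n n"
    using hA hB by (auto simp: R_def Q_def intro: peval_carrier)
  have "R \<noteq> 0\<^sub>m m m" "Q \<noteq> 0\<^sub>m n n"
    unfolding R_def Q_def
    using peval_cofactor_neq_0[OF h A cyclic(1) r] peval_cofactor_neq_0[OF h B cyclic(2) s] by auto
  obtain k where k: "k < m" "row R k \<noteq> 0\<^sub>v m"
  proof -
    obtain k l where "k < m" "l < m" "R $$ (k,l) \<noteq> 0"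
      using \<open>R \<noteq> 0\<^sub>m m m\<close> R by (auto simp: mat_eq_iff)
    then have "row R k $ l \<noteq> 0\<^sub>v m $ l" using R by simp
    then have "row R k \<noteq> 0\<^sub>v m" by auto
    then show thesis using that \<open>k < m\<close> by blast
  qed
  obtain l where l: "l < n" "col Q l \<noteq> 0\<^sub>v n"
  proof -
    obtain k l where "k < n" "l < n" "Q $$ (k,l) \<noteq> 0"
      using \<open>Q \<noteq> 0\<^sub>m n n\<close> Q by (auto simp: mat_eq_iff)
    then have "col Q l $ k \<noteq> 0\<^sub>v n $ k" using Q by simp
    then have "col Q l \<noteq> 0\<^sub>v n" by auto
    then show thesis using that \<open>l < n\<close> by blast
  qed
  have SQ: "map_mat h S * Q \<in> carrier_mat m n" using hS Q by (rule mult_carrier_mat)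
  have "row R k \<bullet> (map_mat h S *\<^sub>v col Q l) = (R * (map_mat h S * Q)) $$ (k,l)"
    using k l R SQ col_mult2[OF hS Q l(1)] by (subst index_mult_mat) auto
  also have "R * (map_mat h S * Q) = 0\<^sub>m m n"
    using rel assoc_mult_mat[OF R hS Q] by (simp add: R_def Q_def)
  finally have "row R k \<bullet> (map_mat h S *\<^sub>v col Q l) = 0" using k l by simp
  moreover have "left_eigenvec (map_mat h A) (row R k)"
    using left_eigenvec_row[OF hA r] k by (simp add: R_def)
  moreover have "right_eigenvec (map_mat h B) (col Q l)"
    using right_eigenvec_col[OF hB s] l by (simp add: Q_def)
  ultimately show False using pairing by blast
qed

text \<open>The extension is an arbitrary field homomorphism \<open>h\<close> over which both
  characteristic polynomials split, so that all eigenvalues lie in the target field; an algebraic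
  closure is one instance.\<close>

theorem theorem3p1:
  fixes A B S :: "'a::field mat"
    and m n :: nat
    and h :: "'a \<Rightarrow> 'k::field"
  assumes "m \<ge> 1" and "n \<ge> 1"
    and "A \<in> carrier_mat m m" and "B \<in> carrier_mat n n" and "S \<in> carrier_mat m n"
    and "field_hom h"
    and "splits_under h (char_poly A)" and "splits_under h (char_poly B)"
  shows "mat_span m n {A ^\<^sub>m i * S * B ^\<^sub>m j | i j. True} = carrier_mat m n \<longleftrightarrow>
    (cyclic_mat A \<and> cyclic_mat B) \<and>
    (\<forall>u v. left_eigenvec (map_mat h A) u \<and> right_eigenvec (map_mat h B) v \<longrightarrow>
       u \<bullet> (map_mat h S *\<^sub>v v) \<noteq> 0)"
proof (intro iffI conjI allI impI)
  assume span: "mat_span m n {A ^\<^sub>m i * S * B ^\<^sub>m j | i j. True} = carrier_mat m n"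
  show "cyclic_mat A" "cyclic_mat B"
    by (fact cyclic_mat_if_span_eq[OF assms(3-5) span assms(1,2)])+
  show "u \<bullet> (map_mat h S *\<^sub>v v) \<noteq> 0"
    if "left_eigenvec (map_mat h A) u \<and> right_eigenvec (map_mat h B) v" for u v
    using eigenvector_pairing_if_span_eq[OF assms(3-6) span] that by blast
next
  assume "(cyclic_mat A \<and> cyclic_mat B) \<and>
    (\<forall>u v. left_eigenvec (map_mat h A) u \<and> right_eigenvec (map_mat h B) v \<longrightarrow>
       u \<bullet> (map_mat h S *\<^sub>v v) \<noteq> 0)"
  then show "mat_span m n {A ^\<^sub>m i * S * B ^\<^sub>m j | i j. True} = carrier_mat m n"
    by (intro span_eq_if_eigenvector_pairing[OF assms(3-8)]) auto
qed

end
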